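(* Let $f_1,\dots,f_m:\mathbb{C}^2\to\mathbb{C}^2$ be complex linear automorphisms represented in some coordinate system by matrices $A_1,\dots,A_m\in SL_2(\mathbb{C})$, such that the induced maps $\psi_i\in PSL_2(\mathbb{C})$ of $\mathbb{C}P^1$ satisfy the open set condition with respect to some proper open subset $V\subset\mathbb{C}P^1$ and that, in some affine chart $\varphi$ of $\mathbb{C}P^1$ with values in $\mathbb{C}$ (whose domain contains $\overline V$), the $\psi_i$ are contractions on $\varphi(\overline V)$ with respect to the Euclidean distance. Let $R_{\mathbf A}=\bigcap_{k=1}^\infty\left(\bigcup_{|I|=k}\psi_I(V)\right)$ be the corresponding residual set. Then $2\dim_H R_{\mathbf A}=s_{\mathbf A}$.
   Context: For a word $I=i_1\dots i_k$ in the letters $1,\dots,m$, $|I|=k$, $A_I=A_{i_1}\cdots A_{i_k}$ and $\psi_I=\psi_{i_1}\circ\dots\circ\psi_{i_k}$. The open set condition with respect to $V$ means that $\psi_1(V),\dots,\psi_m(V)$ are pairwise disjoint and contained in $V$. A contraction is a map with Lipschitz constant strictly less than $1$. $\dim_H$ is Hausdorff dimension (with respect to the round metric on $\mathbb{C}P^1$, equivalently the Euclidean metric in the chart). $\mathbf A$ is the semigroup generated by $A_1,\dots,A_m$. With the max norm $\|M\|=\max_{i,j}|M^i_j|$, its exponent is $s_{\mathbf A}=\sup\{s\ge0:\sum_I\|A_I\|^{-s}=\infty\}$, the sum being over all finite words $I$ in the letters $1,\dots,m$ (including the empty word, for which $A_I$ is the identity).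
   Formalization: V is assumed nonempty, and the equality for R_A is proved when R_A is nonempty (it fails for z/2, (z+1)/2 with V the open unit square, where R_A is empty but s_A=2); the equality is also proved, without that condition, for the residual set formed from the closure of V. *)

theory Defs
  imports "HOL-Analysis.Analysis"
begin

definition proj_rel :: "complex ^ 2 \<Rightarrow> complex ^ 2 \<Rightarrow> bool" where
  "proj_rel v w \<longleftrightarrow> v \<noteq> 0 \<and> w \<noteq> 0 \<and> (\<exists>c. w = c *s v)"

lemma proj_rel_part_equivp: "part_equivp proj_rel"
proof (rule part_equivpI)
  show "\<exists>x. proj_rel x x"
    unfolding proj_rel_def
    by (rule exI[of _ "axis 1 1"]) (auto simp: intro: exI[of _ 1])
  show "symp proj_rel"
  proof (rule sympI)
    fix v w assume "proj_rel v w"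
    then obtain c where c: "v \<noteq> 0" "w \<noteq> 0" "w = c *s v"
      by (auto simp: proj_rel_def)
    then have "c \<noteq> 0" by auto
    then have "v = inverse c *s w" using c by (simp add: vector_smult_assoc)
    then show "proj_rel w v" using c unfolding proj_rel_def by blast
  qed
  show "transp proj_rel"
    by (rule transpI) (auto simp: proj_rel_def vector_smult_assoc)
qed

quotient_type cp1 = "complex ^ 2" / partial: proj_rel
  by (rule proj_rel_part_equivp)

text \<open>The Hopf map identifies the projective line with the unit sphere of
  \<open>complex \<times> real\<close>; the distance below is the great-circle distance on that sphere.\<close>

definition hopf_vec :: "complex ^ 2 \<Rightarrow> complex \<times> real" where
  "hopf_vec v =
     (2 * v $ 1 * cnj (v $ 2) / of_real ((cmod (v $ 1))\<^sup>2 + (cmod (v $ 2))\<^sup>2),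
      ((cmod (v $ 1))\<^sup>2 - (cmod (v $ 2))\<^sup>2) / ((cmod (v $ 1))\<^sup>2 + (cmod (v $ 2))\<^sup>2))"

lemma hopf_vec_scale:
  assumes "c \<noteq> 0" shows "hopf_vec (c *s v) = hopf_vec v"
proof -
  have 1: "(cmod (c * z))\<^sup>2 = (cmod c)\<^sup>2 * (cmod z)\<^sup>2" for z
    by (simp add: norm_mult power_mult_distrib)
  have 2: "2 * (c * x) * cnj (c * y) = of_real ((cmod c)\<^sup>2) * (2 * x * cnj y)" for x y
    by (simp only: complex_norm_square complex_cnj_mult mult_ac)
  have 3: "(cmod c)\<^sup>2 \<noteq> 0" using assms by simp
  show ?thesis
    unfolding hopf_vec_def vector_smult_component 1 2
    unfolding distrib_left[symmetric] right_diff_distrib[symmetric] of_real_mult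
    using 3 assms by simp
qed

lift_definition hopf :: "cp1 \<Rightarrow> complex \<times> real" is hopf_vec
  by (metis hopf_vec_scale proj_rel_def vector_smult_lzero)

lemma norm_hopf: "norm (hopf p) = 1"
proof transfer
  fix v assume "proj_rel v v"
  then have "v \<noteq> 0" by (simp add: proj_rel_def)
  then have "v $ 1 \<noteq> 0 \<or> v $ 2 \<noteq> 0"
    by (auto simp: vec_eq_iff forall_2)
  then have N: "(cmod (v $ 1))\<^sup>2 + (cmod (v $ 2))\<^sup>2 \<noteq> 0" (is "?N \<noteq> 0")
    by (simp add: add_nonneg_eq_0_iff)
  have a: "cmod (of_real ?N) = ?N" by (metis abs_of_nonneg add_nonneg_nonneg norm_of_real zero_le_power2)
  have "(norm (hopf_vec v))\<^sup>2
      = (4 * (cmod (v $ 1))\<^sup>2 * (cmod (v $ 2))\<^sup>2 + ((cmod (v $ 1))\<^sup>2 - (cmod (v $ 2))\<^sup>2)\<^sup>2) / ?N\<^sup>2"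
    unfolding hopf_vec_def norm_Pair
    by (simp only: norm_divide a)
       (simp add: norm_mult power_mult_distrib power_divide add_divide_distrib)
  also have "\<dots> = ?N\<^sup>2 / ?N\<^sup>2" by (simp add: power2_eq_square algebra_simps)
  also have "\<dots> = 1" using N by simp
  finally show "norm (hopf_vec v) = 1"
    by (metis norm_ge_zero power2_eq_1_iff le_minus_one_simps(3))
qed

lemma hopf_inj: "hopf p = hopf q \<Longrightarrow> p = q"
proof transfer
  fix v w :: "complex ^ 2"
  assume "proj_rel v v" "proj_rel w w" and eq: "hopf_vec v = hopf_vec w"
  then have nz: "v \<noteq> 0" "w \<noteq> 0" by (auto simp: proj_rel_def)
  define N where "N u = (cmod (u $ 1))\<^sup>2 + (cmod (u $ 2))\<^sup>2" for u :: "complex ^ 2"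
  have pos: "N u \<noteq> 0" if "u \<noteq> 0" for u
    using that by (auto simp: N_def add_nonneg_eq_0_iff vec_eq_iff forall_2)
  have A: "fst (hopf_vec u) = 2 * u $ 1 * cnj (u $ 2) / of_real (N u)" for u
    by (simp add: hopf_vec_def N_def)
  have B: "1 - snd (hopf_vec u) = 2 * (cmod (u $ 2))\<^sup>2 / N u" if "u \<noteq> 0" for u
    using pos[OF that] by (simp add: hopf_vec_def N_def field_simps)
  have C: "fst (hopf_vec u) * u $ 2 = of_real (1 - snd (hopf_vec u)) * u $ 1" if "u \<noteq> 0" for u
  proof -
    have "of_real ((cmod z)\<^sup>2) = z * cnj z" for z by (rule complex_norm_square)
    then show ?thesis unfolding A B[OF that] of_real_divide of_real_mult by (simp add: mult_ac)
  qed
  have zero: "u $ 2 = 0 \<longleftrightarrow> 1 - snd (hopf_vec u) = 0" if "u \<noteq> 0" for u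
    unfolding B[OF that] using pos[OF that] by simp
  have *: "v $ 1 * w $ 2 = w $ 1 * v $ 2"
  proof (cases "v $ 2 = 0")
    case True
    then have "w $ 2 = 0" using zero[OF nz(1)] zero[OF nz(2)] eq by metis
    then show ?thesis using True by simp
  next
    case False
    define t where "t = complex_of_real (1 - snd (hopf_vec v))"
    have t: "t \<noteq> 0" using False zero[OF nz(1)] unfolding t_def by (metis of_real_eq_0_iff)
    have "t * v $ 1 = fst (hopf_vec v) * v $ 2" "t * w $ 1 = fst (hopf_vec v) * w $ 2"
      using C[OF nz(1)] C[OF nz(2)] eq t_def by simp_all
    then have "t * (v $ 1 * w $ 2) = t * (w $ 1 * v $ 2)"
      by (metis mult.assoc mult.commute)
    then show ?thesis using t by simp
  qed
  have "\<exists>c. w = c *s v"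
  proof (cases "v $ 2 = 0")
    case True
    then have "v $ 1 \<noteq> 0" using nz by (auto simp: vec_eq_iff forall_2)
    then have "w = (w $ 1 / v $ 1) *s v"
      using * by (auto simp: vec_eq_iff forall_2 field_simps)
    then show ?thesis by blast
  next
    case False
    then have "w = (w $ 2 / v $ 2) *s v"
      using * by (auto simp: vec_eq_iff forall_2 field_simps)
    then show ?thesis by blast
  qed
  then show "proj_rel v w" using nz by (simp add: proj_rel_def)
qed

lemma arccos_inner_triangle:
  fixes u v w :: "'a::real_inner"
  assumes u: "norm u = 1" and v: "norm v = 1" and w: "norm w = 1"
  shows "arccos (u \<bullet> w) \<le> arccos (u \<bullet> v) + arccos (v \<bullet> w)"
proof -
  have bd: "\<bar>x \<bullet> y\<bar> \<le> 1" if "norm x = 1" "norm y = 1" for x y :: 'a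
    using Cauchy_Schwarz_ineq2[of x y] that by simp
  define a b where "a = u \<bullet> v" and "b = v \<bullet> w"
  have a: "\<bar>a\<bar> \<le> 1" and b: "\<bar>b\<bar> \<le> 1" and uw: "\<bar>u \<bullet> w\<bar> \<le> 1"
    using bd u v w by (auto simp: a_def b_def)
  have sq: "u \<bullet> u = 1" "v \<bullet> v = 1" "w \<bullet> w = 1"
    using u v w by (simp_all add: dot_square_norm)
  have n1: "norm (u - a *\<^sub>R v) = sqrt (1 - a\<^sup>2)"
    by (simp add: norm_eq_sqrt_inner inner_diff_left inner_diff_right sq a_def
          inner_commute power2_eq_square)
  have n2: "norm (w - b *\<^sub>R v) = sqrt (1 - b\<^sup>2)"
    by (simp add: norm_eq_sqrt_inner inner_diff_left inner_diff_right sq b_def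
          inner_commute power2_eq_square)
  have "(u - a *\<^sub>R v) \<bullet> (w - b *\<^sub>R v) = u \<bullet> w - a * b"
    by (simp add: inner_diff_left inner_diff_right sq a_def b_def inner_commute)
  then have ge: "a * b - sqrt (1 - a\<^sup>2) * sqrt (1 - b\<^sup>2) \<le> u \<bullet> w"
    using Cauchy_Schwarz_ineq2[of "u - a *\<^sub>R v" "w - b *\<^sub>R v"] n1 n2 by (simp add: abs_le_iff)
  have cos: "cos (arccos a + arccos b) = a * b - sqrt (1 - a\<^sup>2) * sqrt (1 - b\<^sup>2)"
    using a b by (simp add: cos_add cos_arccos_abs sin_arccos_abs)
  have nn: "0 \<le> arccos a" "0 \<le> arccos b" "arccos (u \<bullet> w) \<le> pi"
    using a b uw by (auto simp: abs_le_iff intro!: arccos_lbound arccos_ubound)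
  show ?thesis
  proof (cases "arccos a + arccos b \<le> pi")
    case True
    have "arccos (u \<bullet> w) \<le> arccos (cos (arccos a + arccos b))"
      using ge cos uw cos_ge_minus_one[of "arccos a + arccos b"]
      by (intro arccos_le_arccos) (auto simp: abs_le_iff)
    also have "\<dots> = arccos a + arccos b"
      using True nn by (intro arccos_cos) auto
    finally show ?thesis by (simp add: a_def b_def)
  next
    case False
    then show ?thesis using nn by (simp add: a_def b_def)
  qed
qed

instantiation cp1 :: metric_space
begin

definition dist_cp1 :: "cp1 \<Rightarrow> cp1 \<Rightarrow> real" where
  "dist_cp1 p q = arccos (hopf p \<bullet> hopf q)"

definition uniformity_cp1 :: "(cp1 \<times> cp1) filter" where
  "uniformity_cp1 = (INF e\<in>{0<..}. principal {(x, y). dist x y < e})"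

definition open_cp1 :: "cp1 set \<Rightarrow> bool" where
  "open_cp1 U \<longleftrightarrow> (\<forall>x\<in>U. \<forall>\<^sub>F (x', y) in uniformity. x' = x \<longrightarrow> y \<in> U)"

instance
proof
  fix p q r :: cp1
  have *: "\<bar>hopf p \<bullet> hopf q\<bar> \<le> 1"
    using Cauchy_Schwarz_ineq2[of "hopf p" "hopf q"] by (simp add: norm_hopf)
  have **: "(norm (hopf p - hopf q))\<^sup>2 = 2 - 2 * (hopf p \<bullet> hopf q)"
    using dot_norm_neg[of "hopf p" "hopf q"] by (simp add: norm_hopf)
  show "dist p q = 0 \<longleftrightarrow> p = q"
  proof
    assume "dist p q = 0"
    then have "hopf p \<bullet> hopf q = 1"
      using * unfolding dist_cp1_def by (metis cos_arccos_abs cos_zero)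
    then show "p = q" using ** by (auto intro: hopf_inj)
  next
    assume "p = q"
    then show "dist p q = 0"
      by (simp add: dist_cp1_def dot_square_norm norm_hopf)
  qed
  show "dist p q \<le> dist p r + dist q r"
    using arccos_inner_triangle[OF norm_hopf norm_hopf norm_hopf, of p q r]
    by (simp add: dist_cp1_def inner_commute)
qed (simp_all add: uniformity_cp1_def open_cp1_def)

end

text \<open>Independent of the chosen representative for injective linear \<open>f\<close>, see
  \<open>induced_map_abs\<close>; only used for such \<open>f\<close>.\<close>

definition induced_map :: "(complex ^ 2 \<Rightarrow> complex ^ 2) \<Rightarrow> cp1 \<Rightarrow> cp1" where
  "induced_map f p = abs_cp1 (f (rep_cp1 p))"

lemma induced_map_abs:
  assumes lin: "Vector_Spaces.linear (*s) (*s) f" and inj: "inj f" and v: "v \<noteq> 0"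
  shows "induced_map f (abs_cp1 v) = abs_cp1 (f v)"
proof -
  interpret f: Vector_Spaces.linear "(*s)" "(*s)" f by (rule lin)
  have vv: "proj_rel v v" unfolding proj_rel_def using v by (auto intro: exI[of _ 1])
  have "proj_rel (rep_cp1 (abs_cp1 v)) v"
    using vv by (metis Quotient_cp1 Quotient_rep_abs)
  then obtain c where c: "rep_cp1 (abs_cp1 v) \<noteq> 0" "v = c *s rep_cp1 (abs_cp1 v)"
    by (auto simp: proj_rel_def)
  have nz: "f u \<noteq> 0" if "u \<noteq> 0" for u
    using inj f.zero that by (metis injD)
  have "f v = c *s f (rep_cp1 (abs_cp1 v))" using c(2) f.scale by metis
  then have "proj_rel (f (rep_cp1 (abs_cp1 v))) (f v)"
    using nz v c(1) unfolding proj_rel_def by blast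
  then show ?thesis
    unfolding induced_map_def using Quotient_rel_abs[OF Quotient_cp1] by blast
qed

text \<open>An affine chart is given by an invertible matrix \<open>B\<close>: with \<open>w = B *v v\<close>, it sends the
  class of \<open>v\<close> to \<open>w $ 1 / w $ 2\<close>, and its domain is the set where \<open>w $ 2 \<noteq> 0\<close>.\<close>

definition chart_domain :: "complex ^ 2 ^ 2 \<Rightarrow> cp1 set" where
  "chart_domain B = {p. (B *v rep_cp1 p) $ 2 \<noteq> 0}"

definition chart :: "complex ^ 2 ^ 2 \<Rightarrow> cp1 \<Rightarrow> complex" where
  "chart B p = (B *v rep_cp1 p) $ 1 / (B *v rep_cp1 p) $ 2"

definition in_chart :: "complex ^ 2 ^ 2 \<Rightarrow> (cp1 \<Rightarrow> cp1) \<Rightarrow> complex \<Rightarrow> complex" where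
  "in_chart B g = chart B \<circ> g \<circ> inv_into (chart_domain B) (chart B)"

text \<open>The convention is \<open>0 ^ 0 = 1\<close> for nonempty sets, whereas \<open>0 powr 0 = 0\<close>.\<close>

definition diam_pow :: "real \<Rightarrow> 'a::metric_space set \<Rightarrow> ennreal" where
  "diam_pow s C =
     (if C = {} then 0 else if s = 0 then 1 else ennreal (diameter C powr s))"

definition hausdorff_premeasure :: "real \<Rightarrow> real \<Rightarrow> 'a::metric_space set \<Rightarrow> ennreal" where
  "hausdorff_premeasure \<delta> s E =
     Inf {\<Sum>n. diam_pow s (C n) | C :: nat \<Rightarrow> 'a set.
            E \<subseteq> (\<Union>n. C n) \<and> (\<forall>n. bounded (C n) \<and> diameter (C n) \<le> \<delta>)}"

definition hausdorff_measure :: "real \<Rightarrow> 'a::metric_space set \<Rightarrow> ennreal" where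
  "hausdorff_measure s E = (SUP \<delta>\<in>{0<..}. hausdorff_premeasure \<delta> s E)"

definition hausdorff_dim :: "'a::metric_space set \<Rightarrow> ennreal" where
  "hausdorff_dim E = Inf {ennreal s | s. 0 \<le> s \<and> hausdorff_measure s E = 0}"

definition words :: "nat \<Rightarrow> nat list set" where
  "words m = lists {1..m}"

definition word_matrix :: "(nat \<Rightarrow> complex ^ 2 ^ 2) \<Rightarrow> nat list \<Rightarrow> complex ^ 2 ^ 2" where
  "word_matrix A I = foldr (\<lambda>i M. A i ** M) I (mat 1)"

definition word_map :: "(nat \<Rightarrow> 'a \<Rightarrow> 'a) \<Rightarrow> nat list \<Rightarrow> 'a \<Rightarrow> 'a" where
  "word_map \<psi> I = foldr (\<lambda>i g. \<psi> i \<circ> g) I id"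

definition max_norm :: "complex ^ 2 ^ 2 \<Rightarrow> real" where
  "max_norm M = Max {cmod (M $ i $ j) | i j. True}"

definition semigroup_exponent :: "nat \<Rightarrow> (nat \<Rightarrow> complex ^ 2 ^ 2) \<Rightarrow> ennreal" where
  "semigroup_exponent m A =
     Sup {ennreal s | s. 0 \<le> s \<and>
       (\<Sum>\<^sub>\<infinity>I\<in>words m. ennreal (max_norm (word_matrix A I) powr (- s))) = \<infinity>}"

definition open_set_condition :: "nat \<Rightarrow> (nat \<Rightarrow> 'a \<Rightarrow> 'a::topological_space) \<Rightarrow> 'a set \<Rightarrow> bool" where
  "open_set_condition m \<psi> V \<longleftrightarrow>
     open V \<and> disjoint_family_on (\<lambda>i. \<psi> i ` V) {1..m} \<and> (\<forall>i\<in>{1..m}. \<psi> i ` V \<subseteq> V)"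

text \<open>For open \<open>V\<close> this can be empty although the closed residual set, obtained from
  \<open>closure V\<close>, is not: for the two maps \<open>z / 2\<close> and \<open>(z + 1) / 2\<close> and \<open>V\<close> the open unit square
  with vertices \<open>0\<close>, \<open>1\<close>, \<open>1 + \<i>\<close>, \<open>\<i>\<close>, the open set condition holds and the closed residual set is
  the segment from \<open>0\<close> to \<open>1\<close>, which misses \<open>V\<close>.\<close>

definition residual_set :: "nat \<Rightarrow> (nat \<Rightarrow> 'a \<Rightarrow> 'a) \<Rightarrow> 'a set \<Rightarrow> 'a set" where
  "residual_set m \<psi> V =
     (\<Inter>k\<in>{1..}. \<Union>I\<in>{I \<in> words m. length I = k}. word_map \<psi> I ` V)"

end

theory Submission
  imports Defs "HOL-Probability.Infinite_Product_Measure"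
begin

text \<open>
  Put \<open>r\<^sub>I = \<parallel>A\<^sub>I\<parallel>\<^sup>-\<^sup>2\<close>. For \<open>g(z) = (az + b) / (cz + d)\<close> of determinant 1 one has
  \<open>\<bar>g(z) - g(w)\<bar> = \<bar>z - w\<bar> / (\<bar>cz + d\<bar> \<bar>cw + d\<bar>)\<close>. The contraction property keeps the poles of all
  compositions uniformly away from the closure of \<open>V\<close>, so there \<open>\<bar>cz + d\<bar>\<close> is comparable with
  \<open>\<parallel>A\<^sub>I\<parallel>\<close> and \<open>\<psi>\<^sub>I\<close> scales distances by a factor comparable with \<open>r\<^sub>I\<close>. It remains to compare the
  dimension with the critical exponent of \<open>\<Sum>\<^sub>I r\<^sub>I\<^sup>t\<close>.

  If the series converges, its level sums tend to 0, and the images of the closure of \<open>V\<close> under the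
  words of a given length are efficient covers. If it diverges at \<open>t\<close> and \<open>u < t\<close>, then among words
  of one length whose \<open>r\<^sub>I\<close> agree up to a factor 2 the sum \<open>\<Sum>r\<^sub>I\<^sup>u\<close> can be made arbitrarily large. By the
  open set condition each image of the closure of \<open>V\<close> meets boundedly many others in such a family,
  so a positive proportion of the family has pairwise disjoint images. These finitely many maps form
  a system with strong separation whose invariant set has positive \<open>u\<close>-dimensional measure. If the
  open residual set is nonempty, some \<open>\<psi>\<^sub>J\<close> maps the closure of \<open>V\<close> into \<open>V\<close>, and inserting \<open>J\<close>
  after every map puts this invariant set inside the open residual set.
\<close>

subsection \<open>The chordal metric\<close>

text \<open>The area form on \<open>complex ^ 2\<close>. For nonzero vectors,
  \<open>cmod (det2 v w)\<close> divided by the product of the norms is the sine of the angle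
  between the complex lines they span, which makes it the algebraic handle on the metric.\<close>

definition det2 :: "complex ^ 2 \<Rightarrow> complex ^ 2 \<Rightarrow> complex" where
  "det2 v w = v $ 1 * w $ 2 - v $ 2 * w $ 1"

lemma det2_mult: "det2 (M *v v) (M *v w) = det M * det2 v w" for M :: "complex ^ 2 ^ 2"
  by (simp add: det2_def det_2 matrix_vector_mult_def sum_2 algebra_simps)

lemma norm_vec2_sq: "(norm v)\<^sup>2 = (cmod (v $ 1))\<^sup>2 + (cmod (v $ 2))\<^sup>2" for v :: "complex ^ 2"
  by (simp add: norm_vec_def L2_set_def sum_2)

lemma norm_scale_vec2: "norm (c *s v) = cmod c * norm v" for v :: "complex ^ 2"
proof -
  have "(norm (c *s v))\<^sup>2 = (cmod c * norm v)\<^sup>2"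
    by (simp add: norm_vec2_sq power_mult_distrib norm_mult distrib_left)
  then show ?thesis by (metis norm_ge_zero mult_nonneg_nonneg power2_eq_imp_eq)
qed

text \<open>After clearing the denominators \<open>N v\<close> and \<open>N w\<close> this is a
  polynomial identity. Compared with \<open>cos x = 1 - 2 * (sin (x / 2))^2\<close>, it identifies
  the bracket with the sine of half the great-circle distance.\<close>

lemma hopf_inner:
  assumes "v \<noteq> 0" "w \<noteq> 0"
  shows "hopf_vec v \<bullet> hopf_vec w = 1 - 2 * (cmod (det2 v w) / (norm v * norm w))\<^sup>2"
proof -
  define N where "N u = (cmod (u $ 1))\<^sup>2 + (cmod (u $ 2))\<^sup>2" for u :: "complex ^ 2"
  have N: "(norm u)\<^sup>2 = N u" for u by (simp add: norm_vec2_sq N_def)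
  have nz: "N v \<noteq> 0" "N w \<noteq> 0"
    using assms by (simp_all flip: N)
  have f: "fst (hopf_vec u) = (1 / N u) *\<^sub>R (2 * u $ 1 * cnj (u $ 2))" for u
    by (simp add: hopf_vec_def N_def scaleR_conv_of_real)
  have s: "snd (hopf_vec u) = (1 / N u) * ((cmod (u $ 1))\<^sup>2 - (cmod (u $ 2))\<^sup>2)" for u
    by (simp add: hopf_vec_def N_def)
  define X where "X u = 2 * u $ 1 * cnj (u $ 2)" for u :: "complex ^ 2"
  define Y where "Y u = (cmod (u $ 1))\<^sup>2 - (cmod (u $ 2))\<^sup>2" for u :: "complex ^ 2"
  have *: "X v \<bullet> X w + Y v * Y w = N v * N w - 2 * (cmod (det2 v w))\<^sup>2"
    unfolding N_def X_def Y_def det2_def inner_complex_def cmod_power2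
    by (simp add: power2_eq_square algebra_simps)
  have "fst (hopf_vec v) \<bullet> fst (hopf_vec w) = (1 / N v) * (1 / N w) * (X v \<bullet> X w)"
    "snd (hopf_vec v) \<bullet> snd (hopf_vec w) = (1 / N v) * (1 / N w) * (Y v * Y w)"
    unfolding f s X_def[symmetric] Y_def[symmetric] by simp_all
  then have "hopf_vec v \<bullet> hopf_vec w = (1 / N v) * (1 / N w) * (N v * N w - 2 * (cmod (det2 v w))\<^sup>2)"
    by (simp only: inner_prod_def distrib_left[symmetric] *)
  also have "\<dots> = 1 - 2 * (cmod (det2 v w) / (norm v * norm w))\<^sup>2"
    using nz by (simp add: power_divide power_mult_distrib N field_simps)
  finally show ?thesis .
qed

lemma proj_rel_refl: "v \<noteq> 0 \<Longrightarrow> proj_rel v v"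
  unfolding proj_rel_def by (auto intro: exI[of _ 1])

lemma hopf_abs: "v \<noteq> 0 \<Longrightarrow> hopf (abs_cp1 v) = hopf_vec v"
  by (simp add: hopf.abs_eq proj_rel_refl eq_onp_def)

lemma rep_cp1_nonzero: "rep_cp1 p \<noteq> 0"
  using Quotient_rep_reflp[OF Quotient_cp1, of p] by (simp add: proj_rel_def)

lemma abs_rep_cp1: "abs_cp1 (rep_cp1 p) = p"
  by (rule Quotient_abs_rep[OF Quotient_cp1])

lemma cp1_cases: obtains v where "v \<noteq> 0" "p = abs_cp1 v"
  using abs_rep_cp1 rep_cp1_nonzero by metis

lemma rep_abs_cp1:
  assumes "v \<noteq> 0" obtains c where "c \<noteq> 0" "rep_cp1 (abs_cp1 v) = c *s v"
proof -
  have "proj_rel v (rep_cp1 (abs_cp1 v))"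
    using rep_abs_rsp[OF Quotient3_cp1, of v v] proj_rel_refl[OF assms] by simp
  then obtain c where "rep_cp1 (abs_cp1 v) = c *s v" by (auto simp: proj_rel_def)
  moreover then have "c \<noteq> 0" using rep_cp1_nonzero[of "abs_cp1 v"] by auto
  ultimately show ?thesis using that by blast
qed

lemma sin_half_bounds:
  assumes "0 \<le> x" "x \<le> pi" shows "2 * sin (x / 2) \<le> x" "x \<le> pi * sin (x / 2)"
proof -
  show "2 * sin (x / 2) \<le> x" using sin_x_le_x[of "x/2"] assms by simp
  \<comment> \<open>Jordan's inequality: by concavity the sine lies above its chord from 0 to
    pi/2.\<close>
  have conc: "concave_on {0..pi} sin"
  proof -
    have "convex_on {0..pi} (\<lambda>x. - sin x)"
      by (rule f''_ge0_imp_convex[where f' = "\<lambda>x. - cos x" and f'' = "\<lambda>x. sin x"])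
        (auto intro!: derivative_eq_intros sin_ge_zero)
    then show ?thesis by (simp add: concave_on_def)
  qed
  have "sin ((1 - x / pi) *\<^sub>R 0 + (x / pi) *\<^sub>R (pi / 2)) \<ge> (1 - x / pi) * sin 0 + (x / pi) * sin (pi / 2)"
    by (rule concave_onD[OF conc]) (use assms in auto)
  then have "x / pi \<le> sin (x / 2)" by simp
  then show "x \<le> pi * sin (x / 2)" by (simp add: field_simps)
qed

text \<open>Replaces the great-circle distance, up to the factors 2 and pi, by an expression in
  representatives on which matrices act through \<open>det2_mult\<close>.\<close>

lemma dist_abs_cp1:
  assumes "v \<noteq> 0" "w \<noteq> 0"
  shows "2 * (cmod (det2 v w) / (norm v * norm w)) \<le> dist (abs_cp1 v) (abs_cp1 w)"
    and "dist (abs_cp1 v) (abs_cp1 w) \<le> pi * (cmod (det2 v w) / (norm v * norm w))"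
proof -
  define k where "k = cmod (det2 v w) / (norm v * norm w)"
  define x where "x = dist (abs_cp1 v) (abs_cp1 w)"
  have x: "x = arccos (hopf (abs_cp1 v) \<bullet> hopf (abs_cp1 w))" by (simp add: x_def dist_cp1_def)
  have b: "\<bar>hopf (abs_cp1 v) \<bullet> hopf (abs_cp1 w)\<bar> \<le> 1"
    using Cauchy_Schwarz_ineq2[of "hopf (abs_cp1 v)" "hopf (abs_cp1 w)"] by (simp add: norm_hopf)
  have x1: "0 \<le> x" "x \<le> pi" using b unfolding x by (auto simp: abs_le_iff intro!: arccos_lbound arccos_ubound)
  have "cos x = 1 - 2 * k\<^sup>2"
    using b unfolding x k_def by (simp add: hopf_abs assms hopf_inner cos_arccos_abs)
  moreover have "cos x = 1 - 2 * (sin (x/2))\<^sup>2" using cos_double_sin[of "x/2"] by simp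
  ultimately have "k\<^sup>2 = (sin (x/2))\<^sup>2" by simp
  moreover have "0 \<le> k" by (simp add: k_def)
  moreover have "0 \<le> sin (x/2)" using x1 by (intro sin_ge_zero) auto
  ultimately have "k = sin (x/2)" by (metis power2_eq_imp_eq)
  then show "2 * (cmod (det2 v w) / (norm v * norm w)) \<le> dist (abs_cp1 v) (abs_cp1 w)"
    and "dist (abs_cp1 v) (abs_cp1 w) \<le> pi * (cmod (det2 v w) / (norm v * norm w))"
    using sin_half_bounds[OF x1] by (simp_all add: k_def x_def)
qed

text \<open>The projective line is the image of the unit sphere of \<open>complex ^ 2\<close>; the
  upper bound of \<open>dist_abs_cp1\<close> shows that the projection is continuous.\<close>

lemma compact_cp1: "compact (UNIV :: cp1 set)"
proof -
  have "continuous_on (sphere 0 1) abs_cp1"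
    unfolding continuous_on_def
  proof
    fix v :: "complex ^ 2" assume v: "v \<in> sphere 0 1"
    have "((\<lambda>w. pi * (cmod (det2 w v) / (norm w * norm v))) \<longlongrightarrow> pi * (cmod (det2 v v) / (norm v * norm v))) (at v within sphere 0 1)"
      unfolding det2_def using v by (intro tendsto_intros) auto
    then have "((\<lambda>w. pi * (cmod (det2 w v) / (norm w * norm v))) \<longlongrightarrow> 0) (at v within sphere 0 1)"
      by (simp add: det2_def)
    then have "((\<lambda>w. dist (abs_cp1 w) (abs_cp1 v)) \<longlongrightarrow> 0) (at v within sphere 0 1)"
    proof (rule Lim_null_comparison[rotated])
      show "\<forall>\<^sub>F w in at v within sphere 0 1. norm (dist (abs_cp1 w) (abs_cp1 v)) \<le> pi * (cmod (det2 w v) / (norm w * norm v))"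
        unfolding eventually_at
      proof (intro exI[of _ 1] conjI ballI impI)
        fix w assume "w \<in> sphere (0 :: complex ^ 2) 1" "w \<noteq> v \<and> dist w v < 1"
        then show "norm (dist (abs_cp1 w) (abs_cp1 v)) \<le> pi * (cmod (det2 w v) / (norm w * norm v))"
          using dist_abs_cp1(2)[of w v] v by (cases "w = 0"; cases "v = 0") auto
      qed simp
    qed
    then show "(abs_cp1 \<longlongrightarrow> abs_cp1 v) (at v within sphere 0 1)"
      by (subst tendsto_dist_iff)
  qed
  then have "compact (abs_cp1 ` sphere 0 1)" by (rule compact_continuous_image) auto
  moreover have "abs_cp1 ` sphere 0 1 = UNIV"
  proof -
    have "p \<in> abs_cp1 ` sphere 0 1" for p
    proof -
      obtain v where v: "v \<noteq> 0" "p = abs_cp1 v" by (rule cp1_cases)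
      let ?u = "(complex_of_real (1 / norm v)) *s v"
      have "norm ?u = 1"
        unfolding norm_scale_vec2 norm_of_real using v by simp
      moreover have "abs_cp1 ?u = p"
      proof -
        have "proj_rel v ?u" unfolding proj_rel_def using v by auto
        then show ?thesis using v Quotient_rel_abs[OF Quotient_cp1] by metis
      qed
      ultimately show ?thesis by (intro image_eqI[of _ _ ?u]) auto
    qed
    then show ?thesis by auto
  qed
  ultimately show ?thesis by simp
qed

subsection \<open>Self-similar sets with strong separation\<close>

text \<open>Under the product of uniform measures on \<open>E\<close>, a cylinder fixing
  \<open>L j\<close> letters has mass at most \<open>(1 / card E) ^ L j\<close>. Cylinders that
  cover the whole sequence space have total mass at least 1 by countable subadditivity. The index
  set \<open>J\<close> allows some members of the sequence to be discarded.\<close>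

lemma cylinder_cover_ge_1:
  fixes E :: "'e set" and P :: "nat \<Rightarrow> nat \<Rightarrow> 'e" and L :: "nat \<Rightarrow> nat"
  assumes E: "finite E" "E \<noteq> {}"
    and cover: "\<And>\<omega>. \<forall>i. \<omega> i \<in> E \<Longrightarrow> \<exists>j\<in>J. \<forall>i<L j. \<omega> i = P j i"
  shows "1 \<le> (\<Sum>j. if j \<in> J then ennreal ((1 / card E) ^ L j) else 0)"
proof -
  define M :: "nat \<Rightarrow> 'e measure" where "M = (\<lambda>_. uniform_count_measure E)"
  interpret product_prob_space M UNIV
    unfolding M_def product_prob_space_def product_prob_space_axioms_def product_sigma_finite_def
    by (auto intro!: prob_space_uniform_count_measure E prob_space_imp_sigma_finite)
  define c where "c j = {\<omega> \<in> space (PiM UNIV M). \<forall>i<L j. \<omega> i = P j i}" for j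
  have sp: "space (PiM UNIV M) = (\<Pi>\<^sub>E i\<in>UNIV. E)" by (simp add: space_PiM M_def space_uniform_count_measure)
  have c: "c j \<in> sets (PiM UNIV M) \<and> emeasure (PiM UNIV M) (c j) \<le> ennreal ((1 / card E) ^ L j)" for j
  proof (cases "\<forall>i<L j. P j i \<in> E")
    case True
    have "c j = prod_emb UNIV M {..<L j} (\<Pi>\<^sub>E i\<in>{..<L j}. {P j i})"
      unfolding c_def prod_emb_def sp by (auto simp: PiE_iff M_def space_uniform_count_measure)
    moreover have "emeasure (PiM UNIV M) (prod_emb UNIV M {..<L j} (\<Pi>\<^sub>E i\<in>{..<L j}. {P j i}))
        = (\<Prod>i<L j. emeasure (M i) {P j i})"
      by (rule emeasure_PiM_emb) (use True in \<open>auto simp: M_def sets_uniform_count_measure\<close>)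
    moreover have "(\<Prod>i<L j. emeasure (M i) {P j i}) = (\<Prod>i<L j. ennreal (1 / card E))"
      by (intro prod.cong) (use True E in \<open>auto simp: M_def emeasure_uniform_count_measure\<close>)
    moreover have "\<dots> = ennreal ((1 / card E) ^ L j)" by (simp add: ennreal_power)
    moreover have "prod_emb UNIV M {..<L j} (\<Pi>\<^sub>E i\<in>{..<L j}. {P j i}) \<in> sets (PiM UNIV M)"
      by (rule sets_PiM_I) (use True in \<open>auto simp: M_def sets_uniform_count_measure\<close>)
    ultimately show ?thesis by simp
  next
    case False
    \<comment> \<open>A prescribed letter outside \<open>E\<close> is never attained, so this
      cylinder is empty and its bound is trivial.\<close>
    then have "c j = {}" unfolding c_def sp by (auto simp: PiE_iff) metis
    then show ?thesis by simp
  qed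
  have "space (PiM UNIV M) \<subseteq> (\<Union>j\<in>J. c j)"
  proof
    fix \<omega> assume w: "\<omega> \<in> space (PiM UNIV M)"
    then have "\<forall>i. \<omega> i \<in> E" unfolding sp by auto
    from cover[OF this] show "\<omega> \<in> (\<Union>j\<in>J. c j)" using w by (auto simp: c_def)
  qed
  then have "1 \<le> emeasure (PiM UNIV M) (\<Union>j. if j \<in> J then c j else {})"
    using c by (subst P.emeasure_space_1[symmetric], intro emeasure_mono) (auto split: if_splits)
  also have "\<dots> \<le> (\<Sum>j. emeasure (PiM UNIV M) (if j \<in> J then c j else {}))"
    using c by (intro emeasure_subadditive_countably) auto
  also have "\<dots> \<le> (\<Sum>j. if j \<in> J then ennreal ((1 / card E) ^ L j) else 0)"
    using c by (intro suminf_le) auto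
  finally show ?thesis .
qed

text \<open>Each new map is composed on the inside, so for maps of \<open>K\<close> into itself the
  images of \<open>K\<close> form a decreasing sequence, and \<open>\<omega>\<close> is a code for
  the points in their intersection.\<close>

fun comp_seq :: "('e \<Rightarrow> 'a \<Rightarrow> 'a) \<Rightarrow> (nat \<Rightarrow> 'e) \<Rightarrow> nat \<Rightarrow> 'a \<Rightarrow> 'a" where
  "comp_seq h \<omega> 0 = id"
| "comp_seq h \<omega> (Suc n) = comp_seq h \<omega> n \<circ> h (\<omega> n)"

lemma comp_seq_cong: "(\<And>i. i < n \<Longrightarrow> \<omega> i = \<omega>' i) \<Longrightarrow> comp_seq h \<omega> n = comp_seq h \<omega>' n"
  by (induction n) auto

lemma comp_seq_prefix:
  assumes "\<And>e. e \<in> E \<Longrightarrow> h e ` K \<subseteq> K" "\<forall>i. \<omega> i \<in> E" "k \<le> n"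
  shows "comp_seq h \<omega> n ` K \<subseteq> comp_seq h \<omega> k ` K"
  using assms(3)
proof (induction n rule: dec_induct)
  case (step n)
  have "comp_seq h \<omega> (Suc n) ` K = comp_seq h \<omega> n ` (h (\<omega> n) ` K)" by (simp add: image_comp)
  also have "\<dots> \<subseteq> comp_seq h \<omega> n ` K" using assms(1,2) by (intro image_mono) blast
  finally show ?case using step by blast
qed simp

text \<open>A mass distribution argument carried out on codes. A set of small diameter contains only
  points whose codes share a long prefix, by separation and the lower distance bound, and the
  uniform measure of that cylinder is controlled by \<open>diameter powr s\<close> because
  \<open>1 / card E\<close> is at most \<open>a powr s\<close>.\<close>

lemma hausdorff_measure_pos:
  fixes h :: "'e \<Rightarrow> 'a::metric_space \<Rightarrow> 'a" and K T :: "'a set" and a s :: real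
  assumes K: "compact K" "K \<noteq> {}" and E: "finite E" "E \<noteq> {}"
    and cont: "\<And>e. e \<in> E \<Longrightarrow> continuous_on K (h e)"
    and into: "\<And>e. e \<in> E \<Longrightarrow> h e ` K \<subseteq> K"
    and disj: "disjoint_family_on (\<lambda>e. h e ` K) E"
    and a: "0 < a" "a < 1"
    and lower: "\<And>e x y. e \<in> E \<Longrightarrow> x \<in> K \<Longrightarrow> y \<in> K \<Longrightarrow> a * dist x y \<le> dist (h e x) (h e y)"
    and s: "0 \<le> s" "1 \<le> card E * a powr s"
    and T: "\<And>\<omega> x. \<forall>i. \<omega> i \<in> E \<Longrightarrow> \<forall>n. x \<in> comp_seq h \<omega> n ` K \<Longrightarrow> x \<in> T"
  shows "hausdorff_measure s T \<noteq> 0"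
proof -
  define q where "q = real (card E)"
  have q: "1 \<le> q" using E by (simp add: q_def Suc_le_eq card_gt_0_iff)
  have aq: "1 / q \<le> a powr s" using s q by (simp add: q_def field_simps)
  have low: "a ^ n * dist x y \<le> dist (comp_seq h \<omega> n x) (comp_seq h \<omega> n y)"
    if "\<forall>i. \<omega> i \<in> E" "x \<in> K" "y \<in> K" for \<omega> n x y
    using that(2,3)
  proof (induction n arbitrary: x y)
    case (Suc n)
    have "a ^ Suc n * dist x y = a ^ n * (a * dist x y)" by simp
    also have "\<dots> \<le> a ^ n * dist (h (\<omega> n) x) (h (\<omega> n) y)"
      using Suc.prems a that(1) by (intro mult_left_mono lower) auto
    also have "\<dots> \<le> dist (comp_seq h \<omega> n (h (\<omega> n) x)) (comp_seq h \<omega> n (h (\<omega> n) y))"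
      using Suc.prems into[OF spec[OF that(1)]] by (intro Suc.IH) auto
    finally show ?case by simp
  qed simp
  have cs: "compact (comp_seq h \<omega> n ` K) \<and> comp_seq h \<omega> n ` K \<subseteq> K \<and> continuous_on K (comp_seq h \<omega> n)"
    if "\<forall>i. \<omega> i \<in> E" for \<omega> n
  proof -
    have 1: "continuous_on K (comp_seq h \<omega> n)"
    proof (induction n)
      case (Suc n)
      have "continuous_on K (comp_seq h \<omega> n \<circ> h (\<omega> n))"
        by (rule continuous_on_compose[OF cont[OF spec[OF that]] continuous_on_subset[OF Suc into[OF spec[OF that]]]])
      then show ?case by simp
    qed (simp add: id_def)
    have 2: "comp_seq h \<omega> n ` K \<subseteq> K" 
    proof -
      have "comp_seq h \<omega> n ` K \<subseteq> comp_seq h \<omega> 0 ` K" by (rule comp_seq_prefix[OF into that le0])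
      then show ?thesis by simp
    qed
    show ?thesis by (intro conjI 1 2 compact_continuous_image[OF 1 K(1)])
  qed
  have ex: "\<exists>x. \<forall>n. x \<in> comp_seq h \<omega> n ` K" if w: "\<forall>i. \<omega> i \<in> E" for \<omega>
  proof -
    have "K \<inter> (\<Inter>n. comp_seq h \<omega> n ` K) \<noteq> {}"
    proof (rule compact_imp_fip_image[OF K(1)])
      show "closed (comp_seq h \<omega> n ` K)" for n by (rule compact_imp_closed[OF conjunct1[OF cs[OF w]]])
      fix I :: "nat set" assume "finite I"
      obtain x where x: "x \<in> K" using K by blast
      have "comp_seq h \<omega> (Max (insert 0 I)) x \<in> comp_seq h \<omega> n ` K" if "n \<in> I" for n
      proof -
        have "n \<le> Max (insert 0 I)" using that \<open>finite I\<close> by auto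
        from comp_seq_prefix[OF into w this] show ?thesis using imageI[OF x, of "comp_seq h \<omega> (Max (insert 0 I))"] by (rule subsetD)
      qed
      moreover have "comp_seq h \<omega> (Max (insert 0 I)) x \<in> K"
        using subsetD[OF conjunct1[OF conjunct2[OF cs[OF w]]] imageI[OF x]] .
      ultimately show "K \<inter> (\<Inter>n\<in>I. comp_seq h \<omega> n ` K) \<noteq> {}" by blast
    qed
    then show ?thesis by auto
  qed
  \<comment> \<open>The intersection of the nested images may contain several points, as no upper
    Lipschitz bound is assumed. Any choice will do, since only membership in every image is
    used.\<close>
  define \<pi> where "\<pi> \<omega> = (SOME x. \<forall>n. x \<in> comp_seq h \<omega> n ` K)" for \<omega>
  have pi: "\<pi> \<omega> \<in> comp_seq h \<omega> n ` K" if "\<forall>i. \<omega> i \<in> E" for \<omega> n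
    unfolding \<pi>_def using someI_ex[OF ex[OF that]] by simp
  have piT: "\<pi> \<omega> \<in> T" if "\<forall>i. \<omega> i \<in> E" for \<omega>
    using T pi that by blast
  obtain d where d: "0 < d" and sep: "\<And>e e' x y. \<lbrakk>e \<in> E; e' \<in> E; e \<noteq> e'; x \<in> h e ` K; y \<in> h e' ` K\<rbrakk> \<Longrightarrow> d \<le> dist x y"
  proof -
    have "\<exists>d>0. \<forall>x\<in>h (fst p) ` K. \<forall>y\<in>h (snd p) ` K. d \<le> dist x y"
      if p: "p \<in> {p \<in> E \<times> E. fst p \<noteq> snd p}" for p
    proof -
      let ?S = "h (fst p) ` K \<times> h (snd p) ` K"
      have c1: "compact ?S" using p K by (intro compact_Times compact_continuous_image cont) auto
      have c2: "?S \<noteq> {}" using K by simp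
      have c3: "continuous_on ?S (\<lambda>x. dist (fst x) (snd x))" by (intro continuous_intros)
      obtain x where x: "x \<in> ?S" "\<forall>y\<in>?S. dist (fst x) (snd x) \<le> dist (fst y) (snd y)"
        using continuous_attains_inf[OF c1 c2 c3] by (elim bexE)
      have "h (fst p) ` K \<inter> h (snd p) ` K = {}"
        using disjoint_family_onD[OF disj, of "fst p" "snd p"] p by (simp add: mem_Times_iff)
      then have "fst x \<noteq> snd x" using x(1) by (metis mem_Times_iff disjoint_iff)
      then show ?thesis using x(2)
        by (intro exI[of _ "dist (fst x) (snd x)"] conjI ballI) (simp, metis SigmaI fst_conv snd_conv)
    qed
    then have "\<forall>p\<in>{p \<in> E \<times> E. fst p \<noteq> snd p}. \<exists>d. d > 0 \<and> (\<forall>x\<in>h (fst p) ` K. \<forall>y\<in>h (snd p) ` K. d \<le> dist x y)"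
      by (intro ballI)
    from bchoice[OF this] obtain D where D: "\<forall>p\<in>{p \<in> E \<times> E. fst p \<noteq> snd p}. D p > 0 \<and> (\<forall>x\<in>h (fst p) ` K. \<forall>y\<in>h (snd p) ` K. D p \<le> dist x y)"
      by (elim exE)
    \<comment> \<open>The smallest gap between two of the finitely many disjoint compact images; the
      inserted 1 covers the case of a single map.\<close>
    define d where "d = Min (insert 1 (D ` {p \<in> E \<times> E. fst p \<noteq> snd p}))"
    have fin: "finite (insert 1 (D ` {p \<in> E \<times> E. fst p \<noteq> snd p}))" using E by simp
    show ?thesis
    proof (rule that[of d])
      show "0 < d" unfolding d_def using fin D by (subst Min_gr_iff) auto
      fix e e' x y assume *: "e \<in> E" "e' \<in> E" "e \<noteq> e'" "x \<in> h e ` K" "y \<in> h e' ` K"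
      then have "d \<le> D (e, e')" unfolding d_def using fin by (intro Min_le) auto
      moreover have "D (e, e') \<le> dist x y" using bspec[OF D, of "(e, e')"] * by auto
      ultimately show "d \<le> dist x y" by simp
    qed
  qed
  have agree: "\<omega> i = \<omega>' i"
    if w: "\<forall>i. \<omega> i \<in> E" "\<forall>i. \<omega>' i \<in> E" and dist: "dist (\<pi> \<omega>) (\<pi> \<omega>') < d * a ^ l" and "i \<le> l" for \<omega> \<omega>' l i
  proof (rule ccontr)
    assume "\<omega> i \<noteq> \<omega>' i"
    \<comment> \<open>At the first disagreement \<open>k\<close> both points lie in images, under
      the same prefix of length \<open>k\<close>, of sets at distance at least \<open>d\<close>.
      Their distance is therefore at least \<open>d * a ^ k\<close>, which forces \<open>k\<close>
      to exceed \<open>l\<close>.\<close>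
    define k where "k = (LEAST i. \<omega> i \<noteq> \<omega>' i)"
    have k: "\<omega> k \<noteq> \<omega>' k" "k \<le> i"
      unfolding k_def using \<open>\<omega> i \<noteq> \<omega>' i\<close>
      by (fact LeastI[of "\<lambda>i. \<omega> i \<noteq> \<omega>' i" i], fact Least_le[of "\<lambda>i. \<omega> i \<noteq> \<omega>' i" i])
    have eq: "comp_seq h \<omega> k = comp_seq h \<omega>' k"
    proof (rule comp_seq_cong)
      fix j assume "j < k"
      then have "\<not> \<omega> j \<noteq> \<omega>' j" unfolding k_def by (rule not_less_Least)
      then show "\<omega> j = \<omega>' j" by simp
    qed
    obtain x where x: "x \<in> K" "\<pi> \<omega> = comp_seq h \<omega> k (h (\<omega> k) x)"
      using pi[OF w(1), of "Suc k"] unfolding comp_seq.simps o_apply by (elim imageE)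
    obtain y where y: "y \<in> K" "\<pi> \<omega>' = comp_seq h \<omega> k (h (\<omega>' k) y)"
      using pi[OF w(2), of "Suc k"] unfolding comp_seq.simps o_apply eq[symmetric] by (elim imageE)
    have "d * a ^ l \<le> d * a ^ k"
      using a d k \<open>i \<le> l\<close> by (intro mult_left_mono power_decreasing) auto
    also have "\<dots> \<le> a ^ k * dist (h (\<omega> k) x) (h (\<omega>' k) y)"
      using sep[OF spec[OF w(1)] spec[OF w(2)] k(1)] x y a by (simp add: mult.commute)
    also have "\<dots> \<le> dist (\<pi> \<omega>) (\<pi> \<omega>')"
      unfolding x y using into w x y by (intro low) auto
    finally show False using dist by simp
  qed
  \<comment> \<open>If \<open>d a\<^sup>l\<^sup>+\<^sup>1 \<le> diam C < d a\<^sup>l\<close>, the codes of the points of \<open>C\<close> share \<open>l + 1\<close> letters, so \<open>C\<close> has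
    mass at most \<open>q\<^sup>-\<^sup>l\<^sup>-\<^sup>1 \<le> (diam C / d)\<^sup>s\<close>; the term \<open>\<eta>\<close> only serves sets of diameter 0.\<close>
  have key: "\<exists>L p. (\<forall>\<omega>. (\<forall>i. \<omega> i \<in> E) \<longrightarrow> \<pi> \<omega> \<in> C \<longrightarrow> (\<forall>i<L. \<omega> i = p i)) \<and>
      ennreal ((1 / q) ^ L) \<le> ennreal (d powr (- s)) * diam_pow s C + ennreal \<eta>"
    if C: "C \<noteq> {}" "bounded C" and eta: "0 < \<eta>" for C \<eta>
  proof (cases "s = 0")
    \<comment> \<open>For exponent 0 the empty prefix suffices: a nonempty set has
      \<open>diam_pow\<close> equal to 1 and \<open>d powr 0\<close> is 1.\<close>
    case True
    then show ?thesis using C d by (intro exI[of _ 0]) (auto simp: diam_pow_def)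
  next
    case False
    then have s0: "0 < s" using s by simp
    have "a powr s < 1" using powr_less_mono2[OF s0, of a 1] a by simp
    define W where "W = {\<omega>. (\<forall>i. \<omega> i \<in> E) \<and> \<pi> \<omega> \<in> C}"
    obtain p where p: "W \<noteq> {} \<Longrightarrow> p \<in> W" by (meson ex_in_conv)
    have *: "\<forall>\<omega>. (\<forall>i. \<omega> i \<in> E) \<longrightarrow> \<pi> \<omega> \<in> C \<longrightarrow> (\<forall>i<Suc l. \<omega> i = p i)"
      if "diameter C < d * a ^ l" for l
    proof (intro allI impI)
      fix \<omega> i assume w: "\<forall>i. \<omega> i \<in> E" "\<pi> \<omega> \<in> C" "i < Suc l"
      then have "W \<noteq> {}" by (auto simp: W_def)
      from p[OF this] have pW: "\<forall>i. p i \<in> E" "\<pi> p \<in> C" by (auto simp: W_def)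
      have "dist (\<pi> \<omega>) (\<pi> p) \<le> diameter C" using w pW C by (intro diameter_bounded_bound)
      then show "\<omega> i = p i" using agree[of \<omega> p l i] w pW that by auto
    qed
    have dp: "diam_pow s C = ennreal (diameter C powr s)" using C False by (simp add: diam_pow_def)
    have pw: "(1 / q) ^ n \<le> (a ^ n) powr s" for n
    proof -
      have "(1 / q) ^ n \<le> (a powr s) ^ n" using aq q by (intro power_mono) auto
      also have "\<dots> = (a ^ n) powr s" using a by (simp add: powr_realpow[symmetric] powr_powr mult.commute)
      finally show ?thesis .
    qed
    consider "diameter C = 0" | "0 < diameter C" "diameter C < d" | "d \<le> diameter C"
      using diameter_ge_0[OF C(2)] by linarith
    then show ?thesis
    proof cases
      case 1
      obtain l where "(a powr s) ^ l < \<eta>"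
        using real_arch_pow_inv[OF eta \<open>a powr s < 1\<close>] by blast
      have "(1 / q) ^ Suc l \<le> (a powr s) ^ Suc l" using aq q by (intro power_mono) auto
      also have "\<dots> \<le> (a powr s) ^ l" using \<open>a powr s < 1\<close> by (intro power_decreasing) auto
      finally have "(1 / q) ^ Suc l \<le> \<eta>" using \<open>(a powr s) ^ l < \<eta>\<close> by simp
      then have "ennreal ((1 / q) ^ Suc l) \<le> ennreal (d powr (- s)) * diam_pow s C + ennreal \<eta>"
        by (intro add_increasing[OF zero_le] ennreal_leI)
      moreover have "diameter C < d * a ^ l" using 1 d a by simp
      ultimately show ?thesis by (intro exI[of _ "Suc l"] exI[of _ p] conjI *)
    next
      case 2
      obtain n where n: "a ^ n < diameter C / d"
        using real_arch_pow_inv[of "diameter C / d" a] 2 d a by auto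
      define k where "k = (LEAST n. d * a ^ n \<le> diameter C)"
      have k: "d * a ^ k \<le> diameter C"
        unfolding k_def by (rule LeastI[of _ n]) (use n d in \<open>simp add: field_simps\<close>)
      with 2 have "k \<noteq> 0" by (cases k) auto
      then obtain l where l: "k = Suc l" by (cases k) auto
      have lt: "diameter C < d * a ^ l"
        using not_less_Least[of l "\<lambda>n. d * a ^ n \<le> diameter C"] l k_def by auto
      have "(1 / q) ^ Suc l \<le> (a ^ Suc l) powr s" by (rule pw)
      also have "\<dots> \<le> (diameter C / d) powr s"
        using k l d a s by (intro powr_mono2) (auto simp: field_simps)
      also have "\<dots> = d powr (- s) * diameter C powr s"
        using d 2 by (simp add: powr_divide powr_minus field_simps)
      finally have "ennreal ((1 / q) ^ Suc l) \<le> ennreal (d powr (- s)) * diam_pow s C"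
        unfolding dp by (simp add: ennreal_mult'[symmetric] ennreal_leI)
      then have "ennreal ((1 / q) ^ Suc l) \<le> ennreal (d powr (- s)) * diam_pow s C + ennreal \<eta>"
        by (rule add_increasing2[OF zero_le])
      then show ?thesis by (intro exI[of _ "Suc l"] exI[of _ p] conjI *[OF lt])
    next
      case 3
      have "1 \<le> (diameter C / d) powr s" using 3 d s by (intro ge_one_powr_ge_zero) auto
      also have "\<dots> = d powr (- s) * diameter C powr s"
        using d 3 by (simp add: powr_divide powr_minus field_simps)
      finally have "ennreal ((1 / q) ^ 0) \<le> ennreal (d powr (- s)) * diam_pow s C"
        unfolding dp by (simp add: ennreal_mult'[symmetric] ennreal_leI flip: ennreal_1)
      then have "ennreal ((1 / q) ^ 0) \<le> ennreal (d powr (- s)) * diam_pow s C + ennreal \<eta>"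
        by (rule add_increasing2[OF zero_le])
      then show ?thesis by (intro exI[of _ 0]) auto
    qed
  qed
  \<comment> \<open>The error terms granted to the individual sets add up to 1/2, so half of the
    total mass 1 remains for the diameter sum.\<close>
  have main: "ennreal (1/2) \<le> ennreal (d powr (- s)) * (\<Sum>n. diam_pow s (C n))"
    if cov: "T \<subseteq> (\<Union>n. C n)" and bd: "\<And>n. bounded (C n)" for C :: "nat \<Rightarrow> 'a set"
  proof -
    define J where "J = {n. C n \<noteq> {}}"
    have "\<exists>L p. n \<in> J \<longrightarrow> (\<forall>\<omega>. (\<forall>i. \<omega> i \<in> E) \<longrightarrow> \<pi> \<omega> \<in> C n \<longrightarrow> (\<forall>i<L. \<omega> i = p i)) \<and>
      ennreal ((1 / q) ^ L) \<le> ennreal (d powr (- s)) * diam_pow s (C n) + ennreal ((1/2) * (1/2) ^ Suc n)" for n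
      using key[of "C n" "(1/2) * (1/2) ^ Suc n"] bd by (cases "n \<in> J") (auto simp: J_def)
    then obtain L p where Lp: "\<And>n \<omega> i. n \<in> J \<Longrightarrow> (\<forall>i. \<omega> i \<in> E) \<Longrightarrow> \<pi> \<omega> \<in> C n \<Longrightarrow> i < L n \<Longrightarrow> \<omega> i = p n i"
      "\<And>n. n \<in> J \<Longrightarrow> ennreal ((1 / q) ^ L n) \<le> ennreal (d powr (- s)) * diam_pow s (C n) + ennreal ((1/2) * (1/2) ^ Suc n)"
      by metis
    have "1 \<le> (\<Sum>j. if j \<in> J then ennreal ((1 / card E) ^ L j) else 0)"
    proof (rule cylinder_cover_ge_1[OF E, where P = p])
      fix \<omega> :: "nat \<Rightarrow> 'e" assume w: "\<forall>i. \<omega> i \<in> E"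
      then obtain n where "\<pi> \<omega> \<in> C n" using piT[OF w] cov by auto
      then show "\<exists>j\<in>J. \<forall>i<L j. \<omega> i = p j i" using Lp(1)[of n \<omega>] w by (intro bexI[of _ n]) (auto simp: J_def)
    qed
    also have "\<dots> \<le> (\<Sum>n. ennreal (d powr (- s)) * diam_pow s (C n) + ennreal ((1/2) * (1/2) ^ Suc n))"
      using Lp(2) by (intro suminf_le) (auto simp: q_def)
    also have "\<dots> = ennreal (d powr (- s)) * (\<Sum>n. diam_pow s (C n)) + (\<Sum>n. ennreal ((1/2) * (1/2) ^ Suc n))"
      by (simp add: suminf_add[symmetric])
    also have "(\<Sum>n. ennreal ((1/2) * (1/2) ^ Suc n)) = ennreal (1/2)"
      using sums_mult[OF power_half_series, of "1/2"] by (intro suminf_ennreal_eq) auto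
    finally have "1 \<le> ennreal (d powr (- s)) * (\<Sum>n. diam_pow s (C n)) + ennreal (1/2)" .
    moreover have "(1::ennreal) = ennreal (1/2) + ennreal (1/2)"
      by (subst ennreal_plus[symmetric]) simp_all
    ultimately have "ennreal (1/2) + ennreal (1/2) \<le> ennreal (1/2) + ennreal (d powr (- s)) * (\<Sum>n. diam_pow s (C n))"
      by (simp only: add.commute)
    then show ?thesis by (subst (asm) ennreal_add_left_cancel_le) simp
  qed
  show ?thesis
  proof
    assume "hausdorff_measure s T = 0"
    \<comment> \<open>The bound \<open>main\<close> holds for covers by bounded sets of any size, so
      the single scale 1 gives the contradiction: a cover with sum below \<open>d powr s / 4\<close>
      would yield 1/2 at most 1/4.\<close>
    moreover have "hausdorff_premeasure 1 s T \<le> hausdorff_measure s T"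
      unfolding hausdorff_measure_def by (rule SUP_upper) simp
    ultimately have "hausdorff_premeasure 1 s T < ennreal (d powr s / 4)" using d by simp
    then obtain C :: "nat \<Rightarrow> 'a set" where C: "T \<subseteq> (\<Union>n. C n)" "\<And>n. bounded (C n)"
      "(\<Sum>n. diam_pow s (C n)) < ennreal (d powr s / 4)"
      unfolding hausdorff_premeasure_def Inf_less_iff by auto
    have "ennreal (1/2) \<le> ennreal (d powr (- s)) * (\<Sum>n. diam_pow s (C n))"
      by (rule main[OF C(1,2)])
    also have "\<dots> \<le> ennreal (d powr (- s)) * ennreal (d powr s / 4)"
      using C(3) by (intro mult_left_mono) auto
    also have "\<dots> = ennreal (1/4)"
      using d by (simp add: ennreal_mult'[symmetric] powr_minus)
    finally show False by (subst (asm) ennreal_le_iff) simp_all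
  qed
qed

subsection \<open>Words of Moebius transformations\<close>

definition mden :: "complex ^ 2 ^ 2 \<Rightarrow> complex \<Rightarrow> complex" where
  "mden M z = M $ 2 $ 1 * z + M $ 2 $ 2"

definition mnum :: "complex ^ 2 ^ 2 \<Rightarrow> complex \<Rightarrow> complex" where
  "mnum M z = M $ 1 $ 1 * z + M $ 1 $ 2"

definition mob :: "complex ^ 2 ^ 2 \<Rightarrow> complex \<Rightarrow> complex" where
  "mob M z = mnum M z / mden M z"

text \<open>The cocycle rule for denominators, which is the chain rule for Moebius maps. It turns
  bounds for letters into bounds for words.\<close>

lemma mden_mult: "mden Y z \<noteq> 0 \<Longrightarrow> mden (X ** Y) z = mden X (mob Y z) * mden Y z"
  by (simp add: mden_def mnum_def mob_def matrix_matrix_mult_def sum_2 field_simps)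

lemma mnum_mult: "mden Y z \<noteq> 0 \<Longrightarrow> mnum (X ** Y) z = mnum X (mob Y z) * mden Y z"
  by (simp add: mden_def mnum_def mob_def matrix_matrix_mult_def sum_2 field_simps)

lemma mob_mult: "mden Y z \<noteq> 0 \<Longrightarrow> mob (X ** Y) z = mob X (mob Y z)"
  by (simp add: mden_mult mnum_mult mob_def[of X] mob_def[of "X ** Y"])

text \<open>An exact substitute for the mean value theorem: distances are scaled by the two
  denominators alone, so distortion estimates reduce to bounds on \<open>mden\<close>.\<close>

lemma mob_diff:
  assumes "det M = 1" "mden M z \<noteq> 0" "mden M w \<noteq> 0"
  shows "mob M z - mob M w = (z - w) / (mden M z * mden M w)"
proof -
  have "mnum M z * mden M w - mnum M w * mden M z = det M * (z - w)"
    by (simp add: mden_def mnum_def det_2 algebra_simps)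
  then show ?thesis using assms by (simp add: mob_def diff_frac_eq)
qed

lemma mden_id [simp]: "mden (mat 1) z = 1" and mob_id [simp]: "mob (mat 1) z = z"
  by (simp_all add: mden_def mob_def mnum_def mat_def)

lemma word_matrix_simps [simp]:
  "word_matrix A [] = mat 1" "word_matrix A (i # I) = A i ** word_matrix A I"
  by (simp_all add: word_matrix_def)

lemma word_map_simps [simp]:
  "word_map \<psi> [] = id" "word_map \<psi> (i # I) = \<psi> i \<circ> word_map \<psi> I"
  by (simp_all add: word_map_def)

lemma word_map_append: "word_map \<psi> (I @ J) = word_map \<psi> I \<circ> word_map \<psi> J"
  by (induction I) (simp_all add: comp_assoc)

lemma words_simps [simp]: "[] \<in> words m" "i # I \<in> words m \<longleftrightarrow> i \<in> {1..m} \<and> I \<in> words m"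
  by (auto simp: words_def)

lemma words_append [simp]: "I @ J \<in> words m \<longleftrightarrow> I \<in> words m \<and> J \<in> words m"
  by (auto simp: words_def)

lemma word_map_image_subset:
  assumes "\<And>i. i \<in> {1..m} \<Longrightarrow> \<psi> i ` X \<subseteq> X" "W \<in> words m"
  shows "word_map \<psi> W ` X \<subseteq> X"
  using assms(2)
proof (induction W)
  case (Cons i W)
  then have "\<psi> i ` (word_map \<psi> W ` X) \<subseteq> \<psi> i ` X" by (intro image_mono) auto
  also have "\<dots> \<subseteq> X" using assms(1) Cons.prems by simp
  finally show ?case by (simp add: image_comp)
qed simp

lemma det_word_matrix:
  assumes "\<And>i. i \<in> {1..m} \<Longrightarrow> det (A i) = 1" "I \<in> words m"
  shows "det (word_matrix A I) = 1"
  using assms(2) by (induction I) (auto simp: det_mul assms(1))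

lemma word_matrix_conj:
  assumes "Q ** Q' = mat 1" "Q' ** Q = mat 1"
  shows "word_matrix (\<lambda>i. Q ** A i ** Q') I = Q ** word_matrix A I ** Q'"
proof (induction I)
  case (Cons i I)
  have "word_matrix (\<lambda>i. Q ** A i ** Q') (i # I) = Q ** A i ** (Q' ** Q) ** (word_matrix A I ** Q')"
    using Cons by (simp add: matrix_mul_assoc)
  also have "\<dots> = Q ** word_matrix A (i # I) ** Q'" using assms by (simp add: matrix_mul_assoc)
  finally show ?case .
qed (simp add: assms)

lemma max_norm_finite: "finite {cmod (M $ i $ j) | i j. True}" for M :: "complex ^ 2 ^ 2"
proof -
  have "{cmod (M $ i $ j) | i j. True} = (\<lambda>(i, j). cmod (M $ i $ j)) ` UNIV" by auto
  then show ?thesis by (metis finite finite_imageI)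
qed

lemma max_norm_ge: "cmod (M $ i $ j) \<le> max_norm M"
  unfolding max_norm_def by (rule Max_ge[OF max_norm_finite]) auto

lemma max_norm_le_iff: "max_norm M \<le> b \<longleftrightarrow> (\<forall>i j. cmod (M $ i $ j) \<le> b)"
  unfolding max_norm_def by (subst Max_le_iff[OF max_norm_finite]) auto

lemma max_norm_nonneg: "0 \<le> max_norm M"
  using max_norm_ge[of M 1 1] norm_ge_zero order_trans by blast

lemma max_norm_mult: "max_norm (X ** Y) \<le> 2 * (max_norm X * max_norm Y)"
  unfolding max_norm_le_iff
proof (intro allI)
  fix i j
  have *: "cmod (X $ i $ k * Y $ k $ j) \<le> max_norm X * max_norm Y" for k
    unfolding norm_mult by (intro mult_mono max_norm_ge max_norm_nonneg norm_ge_zero)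
  have "cmod ((X ** Y) $ i $ j) \<le> cmod (X $ i $ 1 * Y $ 1 $ j) + cmod (X $ i $ 2 * Y $ 2 $ j)"
    by (simp add: matrix_matrix_mult_def sum_2 norm_triangle_ineq)
  then show "cmod ((X ** Y) $ i $ j) \<le> 2 * (max_norm X * max_norm Y)"
    using *[of 1] *[of 2] by simp
qed

lemma max_norm_pos:
  assumes "det M \<noteq> 0" shows "0 < max_norm M"
proof (rule ccontr)
  assume "\<not> 0 < max_norm M"
  then have "M $ i $ j = 0" for i j
    using max_norm_ge[of M i j] by (smt (verit) norm_le_zero_iff)
  then show False using assms by (simp add: det_2)
qed

lemma one_le_mult: "1 \<le> a \<Longrightarrow> 1 \<le> b \<Longrightarrow> 1 \<le> a * b" for a b :: real
  using mult_mono[of 1 a 1 b] by simp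

lemma divide_le_self: "0 \<le> a \<Longrightarrow> 1 \<le> b \<Longrightarrow> a / b \<le> a" for a b :: real
  using divide_left_mono[of 1 b a] by simp

text \<open>The system seen in an affine chart. \<open>K\<close> lies between the open set
  \<open>U\<close> and its closure, so every point of \<open>K\<close> is a limit of points of
  \<open>U\<close>, while \<open>U\<close> supplies the interior needed for disjointness and ball
  arguments.\<close>

locale mobius_ifs =
  fixes m :: nat and M :: "nat \<Rightarrow> complex ^ 2 ^ 2" and U K :: "complex set" and L :: real
  assumes det1: "\<And>i. i \<in> {1..m} \<Longrightarrow> det (M i) = 1"
    and U: "open U" "U \<subseteq> K" "K \<subseteq> closure U" and bounded_K: "bounded K"
    and den: "\<And>i z. i \<in> {1..m} \<Longrightarrow> z \<in> K \<Longrightarrow> mden (M i) z \<noteq> 0"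
    and maps: "\<And>i z. i \<in> {1..m} \<Longrightarrow> z \<in> K \<Longrightarrow> mob (M i) z \<in> K"
    and L: "0 < L" "L < 1"
    and contraction: "\<And>i z w. i \<in> {1..m} \<Longrightarrow> z \<in> K \<Longrightarrow> w \<in> K \<Longrightarrow>
      cmod (mob (M i) z - mob (M i) w) \<le> L * cmod (z - w)"
begin

text \<open>A Moebius map has derivative \<open>1 / mden\<^sup>2\<close>, so this says that the contraction ratio bounds the
  derivative, including at boundary points.\<close>

lemma contraction_den:
  assumes i: "i \<in> {1..m}" and z: "z \<in> K" shows "1 \<le> L * (cmod (mden (M i) z))\<^sup>2"
proof (rule ccontr)
  assume neg: "\<not> 1 \<le> L * (cmod (mden (M i) z))\<^sup>2"
  define T where "T = {w. L * cmod (mden (M i) z) * cmod (mden (M i) w) < 1}"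
  have "open T" unfolding T_def mden_def by (intro open_Collect_less continuous_intros)
  moreover have "z \<in> T" using neg by (simp add: T_def power2_eq_square mult.assoc)
  \<comment> \<open>The contraction inequality must be divided by the distance, so a point
    \<open>w\<close> different from \<open>z\<close> is needed. The strict inequality defining
    \<open>T\<close> persists near \<open>z\<close>, and points of \<open>closure U\<close> are
    limit points because \<open>U\<close> is open.\<close>
  moreover have "z islimpt U" using U z islimpt_closure_open[OF U(1) refl, of z] by (auto simp: limpt_of_closure)
  ultimately obtain w where w: "w \<in> U" "w \<in> T" "w \<noteq> z" by (metis islimptE)
  then have wK: "w \<in> K" using U by auto
  have "cmod (z - w) / (cmod (mden (M i) z) * cmod (mden (M i) w)) \<le> L * cmod (z - w)"
    using contraction[OF i z wK] mob_diff[OF det1[OF i] den[OF i z] den[OF i wK]]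
    by (simp add: norm_divide norm_mult)
  then have "1 \<le> L * cmod (mden (M i) z) * cmod (mden (M i) w)"
    using w(3) den[OF i z] den[OF i wK] by (simp add: field_simps)
  then show False using w(2) by (simp add: T_def)
qed

text \<open>The \<open>\<epsilon>\<close>-neighbourhood of \<open>K\<close> is mapped into itself without meeting a pole, hence the pole of
  every composition has distance at least \<open>\<epsilon>\<close> from \<open>K\<close>. This is all the bounded distortion needed.\<close>

lemma nbhd_letter:
  obtains \<epsilon> where "0 < \<epsilon>"
    "\<And>i z w. i \<in> {1..m} \<Longrightarrow> z \<in> K \<Longrightarrow> cmod (w - z) < \<epsilon> \<Longrightarrow>
      mden (M i) w \<noteq> 0 \<and> cmod (mob (M i) w - mob (M i) z) < \<epsilon>"
proof
  define S where "S = 1 + (\<Sum>i=1..m. cmod (M i $ 2 $ 1))"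
  define l where "l = 1 / sqrt L"
  have l: "1 < l" using L by (simp add: l_def)
  have "0 \<le> (\<Sum>i=1..m. cmod (M i $ 2 $ 1))" by (intro sum_nonneg) simp
  then have S: "1 \<le> S" by (simp add: S_def)
  \<comment> \<open>On \<open>K\<close> the denominators have modulus at least \<open>l\<close>.
    Over a distance \<open>\<epsilon>\<close> they change by at most
    \<open>S * \<epsilon> = l - 1\<close>, hence remain at least 1, and the map does not increase
    the distance from \<open>z\<close> to a point this close.\<close>
  define \<epsilon> where "\<epsilon> = (l - 1) / S"
  show "0 < \<epsilon>" using l S by (simp add: \<epsilon>_def)
  fix i z w assume i: "i \<in> {1..m}" and z: "z \<in> K" and w: "cmod (w - z) < \<epsilon>"
  have "l\<^sup>2 \<le> (cmod (mden (M i) z))\<^sup>2"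
    using contraction_den[OF i z] L by (simp add: l_def power_divide field_simps)
  then have dz: "l \<le> cmod (mden (M i) z)" by (rule power2_le_imp_le) simp
  have "cmod (M i $ 2 $ 1) \<le> (\<Sum>i=1..m. cmod (M i $ 2 $ 1))"
    using i by (intro member_le_sum) auto
  then have "cmod (M i $ 2 $ 1) * cmod (w - z) \<le> S * \<epsilon>"
    using w S by (intro mult_mono) (auto simp: S_def)
  also have "S * \<epsilon> = l - 1" using S by (simp add: \<epsilon>_def)
  finally have *: "cmod (M i $ 2 $ 1 * (w - z)) \<le> l - 1" by (simp add: norm_mult)
  have "mden (M i) z = mden (M i) w - M i $ 2 $ 1 * (w - z)" by (simp add: mden_def algebra_simps)
  then have "cmod (mden (M i) z) \<le> cmod (mden (M i) w) + cmod (M i $ 2 $ 1 * (w - z))"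
    by (metis norm_triangle_ineq4)
  then have dw: "1 \<le> cmod (mden (M i) w)" using dz * by linarith
  then have nz: "mden (M i) w \<noteq> 0" by auto
  have "1 \<le> cmod (mden (M i) w) * cmod (mden (M i) z)"
    using dw dz l by (intro one_le_mult) auto
  then have "cmod (w - z) / (cmod (mden (M i) w) * cmod (mden (M i) z)) \<le> cmod (w - z)"
    using nz den[OF i z] by (intro divide_le_self) auto
  then have "cmod (mob (M i) w - mob (M i) z) < \<epsilon>"
    using w mob_diff[OF det1[OF i] nz den[OF i z]] by (simp add: norm_divide norm_mult)
  with nz show "mden (M i) w \<noteq> 0 \<and> cmod (mob (M i) w - mob (M i) z) < \<epsilon>" by simp
qed

abbreviation N :: "nat list \<Rightarrow> complex ^ 2 ^ 2" where "N \<equiv> word_matrix M"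

text \<open>The denominator of a word is a product of letter denominators at points of
  \<open>K\<close>, and each factor is at least 1 by \<open>contraction_den\<close> and
  \<open>L < 1\<close>.\<close>

lemma word_maps:
  assumes "I \<in> words m" "z \<in> K" shows "1 \<le> cmod (mden (N I) z) \<and> mob (N I) z \<in> K"
  using assms(1)
proof (induction I)
  case (Cons i I)
  then have i: "i \<in> {1..m}" and IH: "1 \<le> cmod (mden (N I) z)" "mob (N I) z \<in> K" by auto
  then have nz: "mden (N I) z \<noteq> 0" by auto
  have "1 \<le> (cmod (mden (M i) (mob (N I) z)))\<^sup>2"
    using contraction_den[OF i IH(2)] L mult_left_le_one_le[OF zero_le_power2, of L "cmod (mden (M i) (mob (N I) z))"]
    by linarith
  then have "1 \<le> cmod (mden (M i) (mob (N I) z))"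
    by (metis one_power2 power2_le_imp_le norm_ge_zero)
  then have "1 \<le> cmod (mden (M i) (mob (N I) z)) * cmod (mden (N I) z)"
    using IH(1) by (rule one_le_mult)
  then show ?case using nz maps[OF i IH(2)] by (simp add: mden_mult mob_mult norm_mult)
qed (use assms in auto)

lemma den_nz: "I \<in> words m \<Longrightarrow> z \<in> K \<Longrightarrow> mden (N I) z \<noteq> 0"
  using word_maps[of I z] by auto

lemma word_contraction:
  assumes "I \<in> words m" "z \<in> K" "w \<in> K"
  shows "cmod (mob (N I) z - mob (N I) w) \<le> L ^ length I * cmod (z - w)"
  using assms(1)
proof (induction I)
  case (Cons i I)
  then have i: "i \<in> {1..m}" and I: "I \<in> words m" by auto
  have "cmod (mob (N (i # I)) z - mob (N (i # I)) w) \<le> L * cmod (mob (N I) z - mob (N I) w)"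
    using contraction[OF i] word_maps[OF I] den_nz[OF I] assms by (simp add: mob_mult)
  also have "\<dots> \<le> L * (L ^ length I * cmod (z - w))" using L Cons I by (intro mult_left_mono) auto
  finally show ?case by simp
qed simp

text \<open>For a nonzero lower left entry, \<open>cmod (mden (N I) z)\<close> is that entry's
  modulus times the distance from \<open>z\<close> to the pole. The product form of the bound also
  covers words without a finite pole.\<close>

lemma nbhd_word:
  obtains \<epsilon> where "0 < \<epsilon>" "\<And>I z. I \<in> words m \<Longrightarrow> z \<in> K \<Longrightarrow> cmod (N I $ 2 $ 1) * \<epsilon> \<le> cmod (mden (N I) z)"
proof -
  obtain \<epsilon> where e: "0 < \<epsilon>"
    "\<And>i z w. i \<in> {1..m} \<Longrightarrow> z \<in> K \<Longrightarrow> cmod (w - z) < \<epsilon> \<Longrightarrow>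
      mden (M i) w \<noteq> 0 \<and> cmod (mob (M i) w - mob (M i) z) < \<epsilon>"
    using nbhd_letter by blast
  have w: "mden (N I) w \<noteq> 0 \<and> cmod (mob (N I) w - mob (N I) z) < \<epsilon>"
    if "I \<in> words m" "z \<in> K" "cmod (w - z) < \<epsilon>" for I z w
    using that(1)
  proof (induction I)
    case (Cons i I)
    then have i: "i \<in> {1..m}" and I: "I \<in> words m" by auto
    show ?case
      using Cons.IH[OF I] e(2)[OF i conjunct2[OF word_maps[OF I that(2)]]] den_nz[OF I that(2)]
      by (simp add: mden_mult mob_mult)
  qed (use that in auto)
  show ?thesis
  proof (rule that[OF e(1)], rule ccontr)
    fix I z assume I: "I \<in> words m" and z: "z \<in> K" and neg: "\<not> cmod (N I $ 2 $ 1) * \<epsilon> \<le> cmod (mden (N I) z)"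
    then have c: "N I $ 2 $ 1 \<noteq> 0" by auto
    \<comment> \<open>the pole of \<open>N I\<close>\<close>
    define v where "v = z - mden (N I) z / N I $ 2 $ 1"
    have "mden (N I) v = 0" using c by (simp add: v_def mden_def field_simps)
    moreover have "cmod (v - z) < \<epsilon>" using neg c by (simp add: v_def norm_divide field_simps)
    ultimately show False using w[OF I z] by blast
  qed
qed

text \<open>All four entries can be recovered from the denominator \<open>D\<close> at
  \<open>z\<close> and the image point \<open>w\<close>: \<open>c\<close> is bounded by the distance
  of the pole, \<open>d = D - c * z\<close>, \<open>a = c * w + 1 / D\<close> by the determinant,
  and \<open>b = w * D - a * z\<close>. Since \<open>z\<close> and \<open>w\<close> range over a
  bounded set, every entry is bounded by a multiple of \<open>cmod D\<close>.\<close>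

lemma den_max_norm:
  obtains C where "1 \<le> C" "\<And>I z. I \<in> words m \<Longrightarrow> z \<in> K \<Longrightarrow>
    max_norm (N I) \<le> C * cmod (mden (N I) z) \<and> cmod (mden (N I) z) \<le> C * max_norm (N I)"
proof -
  obtain \<epsilon> where e: "0 < \<epsilon>" "\<And>I z. I \<in> words m \<Longrightarrow> z \<in> K \<Longrightarrow> cmod (N I $ 2 $ 1) * \<epsilon> \<le> cmod (mden (N I) z)"
    using nbhd_word by blast
  obtain R0 where R0: "\<And>z. z \<in> K \<Longrightarrow> cmod z \<le> R0" using bounded_K by (auto simp: bounded_iff)
  define R where "R = max R0 1"
  have R: "\<And>z. z \<in> K \<Longrightarrow> cmod z \<le> R" "1 \<le> R" using R0 by (auto simp: R_def le_max_iff_disj)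
  define c0 where "c0 = 1 / \<epsilon>"
  define a0 where "a0 = c0 * R + 1"
  \<comment> \<open>The sum of all constants occurring below, so that it dominates each of
    them.\<close>
  define C where "C = c0 + (1 + c0 * R) + a0 + (R + a0 * R) + (R + 1)"
  have pos: "0 < c0" "0 < a0" using e R by (auto simp: c0_def a0_def add_pos_pos)
  have prods: "0 \<le> c0 * R" "0 \<le> a0 * R" using pos R by auto
  show ?thesis
  proof
    show "1 \<le> C" using pos R prods unfolding C_def by linarith
    fix I z assume I: "I \<in> words m" and z: "z \<in> K"
    let ?a = "N I $ 1 $ 1" and ?b = "N I $ 1 $ 2" and ?c = "N I $ 2 $ 1" and ?d = "N I $ 2 $ 2"
    define D where "D = mden (N I) z"
    define w where "w = mob (N I) z"
    have D: "1 \<le> cmod D" and wK: "w \<in> K" using word_maps[OF I z] by (auto simp: D_def w_def)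
    then have Dnz: "D \<noteq> 0" by auto
    have det: "?a * ?d - ?b * ?c = 1" using det_word_matrix[of m M I] det1 I by (simp add: det_2)
    have c: "cmod ?c \<le> c0 * cmod D" using e(2)[OF I z] e(1) by (simp add: c0_def D_def field_simps)
    have "?d = D - ?c * z" by (simp add: D_def mden_def)
    then have "cmod ?d \<le> cmod D + cmod ?c * cmod z" by (metis norm_triangle_ineq4 norm_mult)
    also have "\<dots> \<le> cmod D + c0 * cmod D * R" using c R(1)[OF z] R(2) pos by (intro add_mono mult_mono) auto
    finally have d: "cmod ?d \<le> (1 + c0 * R) * cmod D" by (simp add: algebra_simps)
    have wD: "w * D = ?a * z + ?b" using Dnz by (simp add: w_def D_def mob_def mnum_def)
    have "?a * D = ?c * (w * D) + 1" unfolding wD using det by (simp add: D_def mden_def algebra_simps)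
    then have "?a = ?c * w + 1 / D" using Dnz by (simp add: field_simps)
    then have "cmod ?a \<le> cmod ?c * cmod w + cmod (1 / D)" by (metis norm_triangle_ineq norm_mult)
    also have "cmod (1 / D) \<le> cmod D" using D proof -
      have "cmod (1 / D) \<le> 1" using divide_le_self[of 1 "cmod D"] D by (simp add: norm_divide)
      then show ?thesis using D by simp
    qed
    also have "cmod ?c * cmod w + cmod D \<le> c0 * cmod D * R + cmod D"
      using c R(1)[OF wK] R(2) pos by (intro add_mono mult_mono) auto
    finally have a: "cmod ?a \<le> a0 * cmod D" by (simp add: a0_def algebra_simps)
    have "?b = w * D - ?a * z" using wD by simp
    then have "cmod ?b \<le> cmod w * cmod D + cmod ?a * cmod z" by (metis norm_triangle_ineq4 norm_mult)
    also have "\<dots> \<le> R * cmod D + a0 * cmod D * R"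
      using a R(1)[OF z] R(1)[OF wK] R(2) pos by (intro add_mono mult_mono) auto
    finally have b: "cmod ?b \<le> (R + a0 * R) * cmod D" by (simp add: algebra_simps)
    have le: "x * cmod D \<le> C * cmod D" if "x \<le> C" for x using that by (rule mult_right_mono) simp
    have "c0 \<le> C" "1 + c0 * R \<le> C" "a0 \<le> C" "R + a0 * R \<le> C" "R + 1 \<le> C"
      using pos R prods unfolding C_def by linarith+
    note le = le[OF this(1)] le[OF this(2)] le[OF this(3)] le[OF this(4)] this(5)
    have "max_norm (N I) \<le> C * cmod D"
      unfolding max_norm_le_iff forall_2 using a b c d le by linarith
    moreover have "cmod D \<le> C * max_norm (N I)"
    proof -
      have "cmod D \<le> cmod ?c * cmod z + cmod ?d" unfolding D_def mden_def by (metis norm_triangle_ineq norm_mult)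
      also have "\<dots> \<le> max_norm (N I) * R + max_norm (N I)"
        using R(1)[OF z] R(2) by (intro add_mono mult_mono max_norm_ge max_norm_nonneg) auto
      also have "\<dots> = (R + 1) * max_norm (N I)" by (simp add: algebra_simps)
      also have "\<dots> \<le> C * max_norm (N I)" using le(5) max_norm_nonneg by (rule mult_right_mono)
      finally show ?thesis .
    qed
    ultimately show "max_norm (N I) \<le> C * cmod (mden (N I) z) \<and> cmod (mden (N I) z) \<le> C * max_norm (N I)"
      by (simp add: D_def)
  qed
qed

text \<open>The image of \<open>U\<close> contains a ball whose radius is comparable with the
  derivative at \<open>z0\<close>. Instead of a general distortion theorem, the Moebius map is
  inverted explicitly near the image of \<open>z0\<close>.\<close>

lemma image_ball:
  assumes "z0 \<in> U"
  obtains \<eta> where "0 < \<eta>" "\<And>I w. I \<in> words m \<Longrightarrow>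
    cmod (w - mob (N I) z0) < \<eta> / (cmod (mden (N I) z0))\<^sup>2 \<Longrightarrow> w \<in> mob (N I) ` U"
proof -
  obtain \<epsilon> where e: "0 < \<epsilon>" "\<And>I z. I \<in> words m \<Longrightarrow> z \<in> K \<Longrightarrow> cmod (N I $ 2 $ 1) * \<epsilon> \<le> cmod (mden (N I) z)"
    using nbhd_word by blast
  obtain r where r: "0 < r" "ball z0 r \<subseteq> U" by (rule openE[OF U(1) assms])
  \<comment> \<open>The half absorbs a factor 2 twice: \<open>2 * \<eta> \<le> \<epsilon>\<close>
    keeps \<open>X\<close> away from 0, and \<open>2 * \<eta> \<le> r\<close> keeps the preimage
    inside the ball around \<open>z0\<close>.\<close>
  define \<eta> where "\<eta> = min r \<epsilon> / 2"
  have eta: "0 < \<eta>" "2 * \<eta> \<le> r" "2 * \<eta> \<le> \<epsilon>" using r e by (auto simp: \<eta>_def)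
  show ?thesis
  proof (rule that[OF eta(1)])
    fix I w assume I: "I \<in> words m" and w: "cmod (w - mob (N I) z0) < \<eta> / (cmod (mden (N I) z0))\<^sup>2"
    have z0: "z0 \<in> K" using assms U by auto
    define D where "D = mden (N I) z0"
    define \<delta> where "\<delta> = w - mob (N I) z0"
    define c where "c = N I $ 2 $ 1"
    \<comment> \<open>By \<open>mob_diff\<close> the preimage must satisfy
      \<open>z - z0 = \<delta> * D * mden (N I) z\<close>. As \<open>mden\<close> is affine in
      \<open>z\<close>, this is a linear equation, and \<open>X\<close> is the reciprocal of the
      denominator at its solution.\<close>
    define X where "X = 1 / D - c * \<delta>"
    define z where "z = z0 + \<delta> * D / X"
    have Dnz: "D \<noteq> 0" using den_nz[OF I z0] by (simp add: D_def)
    then have Dpos: "0 < cmod D" by simp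
    have d: "cmod \<delta> < \<eta> / (cmod D)\<^sup>2" using w by (simp add: \<delta>_def D_def)
    then have d': "2 * (cmod \<delta> * (cmod D * cmod D)) < 2 * \<eta>" using Dpos by (simp add: pos_less_divide_eq power2_eq_square)
    have "2 * (cmod c * cmod \<delta> * cmod D) * (\<epsilon> * cmod D) = (cmod c * \<epsilon>) * (2 * (cmod \<delta> * (cmod D * cmod D)))"
      by (simp add: algebra_simps)
    also have "\<dots> \<le> cmod D * \<epsilon>"
      using e(2)[OF I z0] d' eta e(1) unfolding c_def D_def by (intro mult_mono) auto
    finally have "2 * (cmod c * cmod \<delta> * cmod D) \<le> 1"
      using e(1) Dpos by (simp add: mult.commute)
    then have "cmod (c * \<delta>) \<le> 1 / (2 * cmod D)" using Dpos by (simp add: norm_mult field_simps)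
    moreover have "cmod (1 / D) \<le> cmod X + cmod (c * \<delta>)"
      unfolding X_def by (metis diff_add_cancel norm_triangle_ineq)
    moreover have "1 / cmod D = 1 / (2 * cmod D) + 1 / (2 * cmod D)" using Dpos by (simp add: field_simps)
    moreover have "cmod (1 / D) = 1 / cmod D" by (simp add: norm_divide)
    ultimately have X: "1 / (2 * cmod D) \<le> cmod X" by linarith
    have Xpos: "0 < cmod X" by (rule order_less_le_trans[OF _ X]) (use Dpos in simp)
    then have Xnz: "X \<noteq> 0" by auto
    have "cmod (z - z0) = cmod \<delta> * cmod D / cmod X" by (simp add: z_def norm_divide norm_mult)
    also have "\<dots> \<le> cmod \<delta> * cmod D / (1 / (2 * cmod D))"
      using X Dpos Xpos by (intro divide_left_mono mult_pos_pos) auto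
    also have "\<dots> = 2 * (cmod \<delta> * (cmod D * cmod D))" using Dpos by simp
    finally have "dist z0 z < r" using d' eta by (simp add: dist_norm norm_minus_commute)
    then have zU: "z \<in> U" using r by auto
    then have zK: "z \<in> K" using U by auto
    have "mden (N I) z = D + c * (\<delta> * D / X)" by (simp add: z_def mden_def D_def c_def algebra_simps)
    also have "\<dots> = D * (X + c * \<delta>) / X" using Xnz by (simp add: field_simps)
    also have "\<dots> = 1 / X" using Dnz by (simp add: X_def)
    finally have mz: "mden (N I) z = 1 / X" .
    have "mob (N I) z - mob (N I) z0 = (z - z0) / (mden (N I) z * D)"
      unfolding D_def using det1 I by (intro mob_diff det_word_matrix[of m] den_nz zK z0)
    also have "\<dots> = \<delta>" unfolding mz using Dnz Xnz by (simp add: z_def)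
    finally have "w = mob (N I) z" by (simp add: \<delta>_def)
    then show "w \<in> mob (N I) ` U" using zU by blast
  qed
qed

end

subsection \<open>Iterated function systems with bounded distortion\<close>

text \<open>The finite cover is padded with empty sets, which contribute 0 by the convention in
  \<open>diam_pow\<close>.\<close>

lemma hausdorff_premeasure_finite_cover:
  fixes X :: "'i \<Rightarrow> 'a::metric_space set"
  assumes "finite W" "E \<subseteq> (\<Union>I\<in>W. X I)" "0 \<le> \<delta>"
    "\<And>I. I \<in> W \<Longrightarrow> bounded (X I) \<and> diameter (X I) \<le> \<delta>"
  shows "hausdorff_premeasure \<delta> s E \<le> (\<Sum>I\<in>W. diam_pow s (X I))"
proof -
  obtain f where f: "bij_betw f {0..<card W} W" using ex_bij_betw_nat_finite[OF assms(1)] by blast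
  define C where "C n = (if n < card W then X (f n) else {})" for n
  have fW: "f n \<in> W" if "n < card W" for n using f that by (auto simp: bij_betw_def)
  have "E \<subseteq> (\<Union>n. C n)"
  proof
    fix x assume "x \<in> E"
    then obtain I where "I \<in> W" "x \<in> X I" using assms(2) by auto
    then obtain n where "n < card W" "I = f n"
      using bij_betw_imp_surj_on[OF f] by (metis atLeastLessThan_iff imageE)
    then show "x \<in> (\<Union>n. C n)" using \<open>x \<in> X I\<close> by (auto simp: C_def intro!: exI[of _ n])
  qed
  moreover have "bounded (C n) \<and> diameter (C n) \<le> \<delta>" for n
    using assms(3) assms(4)[OF fW] by (simp add: C_def diameter_def[of "{}"])
  ultimately have "hausdorff_premeasure \<delta> s E \<le> (\<Sum>n. diam_pow s (C n))"
    unfolding hausdorff_premeasure_def by (intro Inf_lower) auto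
  also have "\<dots> = (\<Sum>n\<in>{0..<card W}. diam_pow s (C n))"
    by (intro suminf_finite) (auto simp: C_def diam_pow_def)
  also have "\<dots> = (\<Sum>n\<in>{0..<card W}. diam_pow s (X (f n)))" by (simp add: C_def)
  also have "\<dots> = (\<Sum>I\<in>W. diam_pow s (X I))" by (rule sum.reindex_bij_betw[OF f])
  finally show ?thesis .
qed

text \<open>Greedy selection: pick an element, discard the at most \<open>n\<close> elements related
  to it, and continue with the rest.\<close>

lemma independent_subset:
  assumes "finite D" and refl: "\<And>x. x \<in> D \<Longrightarrow> R x x" and sym: "\<And>x y. R x y \<Longrightarrow> R y x"
    and card: "\<And>x. x \<in> D \<Longrightarrow> card {y \<in> D. R x y} \<le> n"
  obtains E where "E \<subseteq> D" "card D \<le> n * card E" "\<And>x y. x \<in> E \<Longrightarrow> y \<in> E \<Longrightarrow> x \<noteq> y \<Longrightarrow> \<not> R x y"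
proof -
  have "\<exists>E\<subseteq>D. card D \<le> n * card E \<and> (\<forall>x\<in>E. \<forall>y\<in>E. x \<noteq> y \<longrightarrow> \<not> R x y)"
    using assms(1) refl card
  proof (induction D rule: finite_psubset_induct)
    case (psubset D)
    show ?case
    proof (cases "D = {}")
      case False
      then obtain x where x: "x \<in> D" by blast
      define D' where "D' = {y \<in> D. \<not> R x y}"
      have "D' \<subset> D" using x psubset.prems(1)[OF x] by (auto simp: D'_def)
      moreover have "card {y \<in> D'. R z y} \<le> n" if "z \<in> D'" for z
      proof -
        have "card {y \<in> D'. R z y} \<le> card {y \<in> D. R z y}"
          using psubset.hyps by (intro card_mono) (auto simp: D'_def)
        then show ?thesis using psubset.prems(2)[of z] that by (auto simp: D'_def)
      qed
      moreover have "R z z" if "z \<in> D'" for z using that psubset.prems(1) by (auto simp: D'_def)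
      ultimately obtain E where E: "E \<subseteq> D'" "card D' \<le> n * card E" "\<forall>x\<in>E. \<forall>y\<in>E. x \<noteq> y \<longrightarrow> \<not> R x y"
        using psubset.IH[of D'] by blast
      have "D = D' \<union> {y \<in> D. R x y}" by (auto simp: D'_def)
      then have "card D \<le> card D' + card {y \<in> D. R x y}" by (metis card_Un_le)
      also have "\<dots> \<le> n * card E + n" using E psubset.prems(2)[OF x] by linarith
      also have "\<dots> = n * card (insert x E)"
      proof -
        have "x \<notin> E" using E psubset.prems(1)[OF x] by (auto simp: D'_def)
        moreover have "finite E" using E psubset.hyps by (auto simp: D'_def intro: finite_subset)
        ultimately show ?thesis by simp
      qed
      finally show ?thesis using E x sym
        by (intro exI[of _ "insert x E"]) (auto simp: D'_def)
    qed simp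
  qed
  then show ?thesis using that by blast
qed

lemma finite_words_length: "finite {I \<in> words m. length I = k}"
  using finite_lists_length_eq[of "{1..m}" k] by (simp add: words_def lists_eq_set conj_commute Collect_conj_eq Int_commute)

text \<open>The image under a word lies in the image under each of its prefixes, so arbitrarily long
  words suffice to reach every level.\<close>

lemma word_map_mem_residual:
  assumes X: "\<And>i. i \<in> {1..m} \<Longrightarrow> \<psi> i ` X \<subseteq> X"
    and x: "\<And>n. \<exists>W\<in>words m. n \<le> length W \<and> x \<in> word_map \<psi> W ` X"
  shows "x \<in> residual_set m \<psi> X"
  unfolding residual_set_def
proof clarify
  fix k :: nat
  have sub: "word_map \<psi> W ` X \<subseteq> X" if "W \<in> words m" for W
    using X that by (rule word_map_image_subset)
  obtain W where W: "W \<in> words m" "k \<le> length W" "x \<in> word_map \<psi> W ` X" using x by blast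
  have tw: "take k W \<in> words m" "drop k W \<in> words m" using W(1) words_append[of "take k W" "drop k W"] by auto
  have "x \<in> word_map \<psi> (take k W) ` (word_map \<psi> (drop k W) ` X)"
    using W(3) word_map_append[of \<psi> "take k W" "drop k W"] by (simp add: image_comp)
  then have "x \<in> word_map \<psi> (take k W) ` X" using sub[OF tw(2)] by blast
  then show "x \<in> (\<Union>I\<in>{I \<in> words m. length I = k}. word_map \<psi> I ` X)"
    using tw W(2) by (intro UN_I[of "take k W"]) auto
qed

lemma residual_set_mono: "X \<subseteq> Y \<Longrightarrow> residual_set m \<psi> X \<subseteq> residual_set m \<psi> Y"
  unfolding residual_set_def by (intro INT_anti_mono UN_mono order_refl subset_refl image_mono) auto

text \<open>The metric facts that the dimension argument uses, freed from projective geometry.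
  \<open>r I\<close> stands for the contraction ratio of the word \<open>I\<close> up to constants,
  and \<open>overlap\<close> is the form in which the open set condition enters.\<close>

locale conformal_ifs =
  fixes m :: nat and \<psi> :: "nat \<Rightarrow> 'a::metric_space \<Rightarrow> 'a" and V :: "'a set"
    and r :: "nat list \<Rightarrow> real" and c C L :: real and N :: nat
  assumes V: "open V" "V \<noteq> {}" and compact: "compact (closure V)"
    and maps: "\<And>i. i \<in> {1..m} \<Longrightarrow> \<psi> i ` V \<subseteq> V" "\<And>i. i \<in> {1..m} \<Longrightarrow> \<psi> i ` closure V \<subseteq> closure V"
    and r_pos: "\<And>I. I \<in> words m \<Longrightarrow> 0 < r I"
    and c: "0 < c" and L: "0 < L" "L < 1"
    and lower: "\<And>I x y. I \<in> words m \<Longrightarrow> x \<in> closure V \<Longrightarrow> y \<in> closure V \<Longrightarrow>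
      c * r I * dist x y \<le> dist (word_map \<psi> I x) (word_map \<psi> I y)"
    and upper: "\<And>I x y. I \<in> words m \<Longrightarrow> x \<in> closure V \<Longrightarrow> y \<in> closure V \<Longrightarrow>
      dist (word_map \<psi> I x) (word_map \<psi> I y) \<le> C * r I * dist x y"
    and decay: "\<And>I. I \<in> words m \<Longrightarrow> r I \<le> C * L ^ length I"
    and overlap: "\<And>k \<tau> D I. D \<subseteq> {I \<in> words m. length I = k} \<Longrightarrow> \<forall>I\<in>D. \<tau> / 2 < r I \<and> r I \<le> \<tau> \<Longrightarrow> I \<in> D \<Longrightarrow>
      card {J \<in> D. word_map \<psi> I ` closure V \<inter> word_map \<psi> J ` closure V \<noteq> {}} \<le> N"
begin

lemma C_pos: "0 < C"
  using decay[of "[]"] r_pos[of "[]"] by simp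

lemma word_maps_closure: "I \<in> words m \<Longrightarrow> word_map \<psi> I ` closure V \<subseteq> closure V"
  by (rule word_map_image_subset[OF maps(2)])

lemma diameter_word:
  assumes I: "I \<in> words m"
  shows "bounded (word_map \<psi> I ` closure V)"
    "diameter (word_map \<psi> I ` closure V) \<le> C * r I * diameter (closure V)"
proof -
  show 1: "bounded (word_map \<psi> I ` closure V)"
    using word_maps_closure[OF I] compact compact_imp_bounded bounded_subset by metis
  show "diameter (word_map \<psi> I ` closure V) \<le> C * r I * diameter (closure V)"
  proof -
    have ne: "word_map \<psi> I ` closure V \<noteq> {}" using V by auto
    have "dist x y \<le> C * r I * diameter (closure V)"
      if "x \<in> word_map \<psi> I ` closure V" "y \<in> word_map \<psi> I ` closure V" for x y
    proof -
      from that obtain u v where uv: "u \<in> closure V" "v \<in> closure V" "x = word_map \<psi> I u" "y = word_map \<psi> I v"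
        by blast
      have "dist x y \<le> C * r I * dist u v" using upper[OF I] uv by simp
      also have "\<dots> \<le> C * r I * diameter (closure V)"
        using C_pos r_pos[OF I] uv compact compact_imp_bounded
        by (intro mult_left_mono diameter_bounded_bound) auto
      finally show ?thesis .
    qed
    then show ?thesis unfolding diameter_def using ne by (auto intro!: cSUP_least)
  qed
qed

text \<open>Grouping the convergent series by word length shows that the level sums tend to 0. These
  sums bound, up to a constant, the cost of covering by the cylinders of one level, whose diameters
  also tend to 0 by \<open>decay\<close>.\<close>

lemma hausdorff_measure_residual_eq_0:
  assumes t: "0 < t" and sm: "(\<lambda>I. r I powr t) summable_on words m"
  shows "hausdorff_measure t (residual_set m \<psi> (closure V)) = 0"
proof -
  define S where "S k = (\<Sum>I\<in>{I \<in> words m. length I = k}. r I powr t)" for k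
  have "summable S"
  proof (rule summableI_nonneg_bounded)
    show "0 \<le> S n" for n by (simp add: S_def sum_nonneg)
    fix n
    have fin: "finite {I \<in> words m. length I < n}"
    proof -
      have "{I \<in> words m. length I < n} = (\<Union>k<n. {I \<in> words m. length I = k})" by auto
      then show ?thesis using finite_words_length by simp
    qed
    have "(\<Sum>k<n. S k) = (\<Sum>k<n. \<Sum>I\<in>{I \<in> {I \<in> words m. length I < n}. length I = k}. r I powr t)"
      unfolding S_def by (intro sum.cong refl arg_cong[of _ _ "sum _"]) auto
    also have "\<dots> = (\<Sum>I\<in>{I \<in> words m. length I < n}. r I powr t)"
      using fin by (intro sum.group) auto
    also have "\<dots> \<le> infsum (\<lambda>I. r I powr t) (words m)"
      using fin sm by (intro finite_sum_le_infsum) auto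
    finally show "(\<Sum>k<n. S k) \<le> infsum (\<lambda>I. r I powr t) (words m)" .
  qed
  then have S0: "S \<longlonglongrightarrow> 0" by (rule summable_LIMSEQ_zero)
  define d where "d = C * diameter (closure V)"
  have d: "0 \<le> d" using C_pos diameter_ge_0[OF compact_imp_bounded[OF compact]] by (simp add: d_def)
  have "hausdorff_premeasure \<delta> t (residual_set m \<psi> (closure V)) = 0" if \<delta>: "0 < \<delta>" for \<delta>
  proof -
    have "(\<lambda>k. d * (C * L ^ k)) \<longlonglongrightarrow> d * (C * 0)"
      using L by (intro tendsto_intros LIMSEQ_realpow_zero) auto
    then have "\<forall>\<^sub>F k in sequentially. d * (C * L ^ k) < \<delta>"
      using \<delta> by (intro order_tendstoD(2)) auto
    then have "\<forall>\<^sub>F k in sequentially. hausdorff_premeasure \<delta> t (residual_set m \<psi> (closure V)) \<le> ennreal (d powr t * S k)"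
      using eventually_ge_at_top[of 1]
    proof eventually_elim
      fix k :: nat assume k: "d * (C * L ^ k) < \<delta>" "1 \<le> k"
      have diam: "diameter (word_map \<psi> I ` closure V) \<le> d * r I" if "I \<in> words m" for I
        using diameter_word(2)[OF that] by (simp add: d_def mult_ac)
      have "hausdorff_premeasure \<delta> t (residual_set m \<psi> (closure V))
          \<le> (\<Sum>I\<in>{I \<in> words m. length I = k}. diam_pow t (word_map \<psi> I ` closure V))"
      proof (rule hausdorff_premeasure_finite_cover[OF finite_words_length])
        show "residual_set m \<psi> (closure V) \<subseteq> (\<Union>I\<in>{I \<in> words m. length I = k}. word_map \<psi> I ` closure V)"
          unfolding residual_set_def using k by (intro INT_lower) simp
        fix I assume "I \<in> {I \<in> words m. length I = k}"
        then have I: "I \<in> words m" "length I = k" by auto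
        have "d * r I \<le> d * (C * L ^ k)" using decay[OF I(1)] I d by (intro mult_left_mono) auto
        then show "bounded (word_map \<psi> I ` closure V) \<and> diameter (word_map \<psi> I ` closure V) \<le> \<delta>"
          using diameter_word(1)[OF I(1)] diam[OF I(1)] k by linarith
      qed (use \<delta> in simp)
      also have "\<dots> \<le> (\<Sum>I\<in>{I \<in> words m. length I = k}. ennreal (d powr t * r I powr t))"
      proof (rule sum_mono)
        fix I assume "I \<in> {I \<in> words m. length I = k}"
        then have I: "I \<in> words m" by auto
        have "diameter (word_map \<psi> I ` closure V) powr t \<le> (d * r I) powr t"
          using t diam[OF I] diameter_ge_0[OF diameter_word(1)[OF I]] by (intro powr_mono2) auto
        also have "\<dots> = d powr t * r I powr t" using d r_pos[OF I] by (simp add: powr_mult)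
        finally show "diam_pow t (word_map \<psi> I ` closure V) \<le> ennreal (d powr t * r I powr t)"
          using t by (simp add: diam_pow_def ennreal_leI)
      qed
      also have "\<dots> = ennreal (d powr t * S k)"
        by (simp add: sum_ennreal S_def sum_distrib_left)
      finally show "hausdorff_premeasure \<delta> t (residual_set m \<psi> (closure V)) \<le> ennreal (d powr t * S k)" .
    qed
    moreover have "(\<lambda>k. ennreal (d powr t * S k)) \<longlonglongrightarrow> ennreal (d powr t * 0)"
      using S0 by (intro tendsto_intros)
    ultimately have "hausdorff_premeasure \<delta> t (residual_set m \<psi> (closure V)) \<le> ennreal (d powr t * 0)"
      by (intro tendsto_lowerbound[of _ _ sequentially]) auto
    then show ?thesis by simp
  qed
  then show ?thesis unfolding hausdorff_measure_def by simp
qed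

text \<open>The dyadic size class of \<open>r I\<close>, measured relative to \<open>C\<close>
  because \<open>decay\<close> gives \<open>r I \<le> C\<close>; this is what makes the upper bound
  hold in class 0.\<close>

definition bucket :: "nat list \<Rightarrow> nat" where
  "bucket I = (LEAST n. C * (1/2) ^ Suc n < r I)"

lemma bucket:
  assumes I: "I \<in> words m"
  shows "C * (1/2) ^ bucket I / 2 < r I" "r I \<le> C * (1/2) ^ bucket I"
proof -
  obtain n where n: "(1/2) ^ n < r I / C"
    using real_arch_pow_inv[of "r I / C" "1/2"] r_pos[OF I] C_pos by auto
  have "C * (1/2) ^ Suc n \<le> C * (1/2) ^ n" using C_pos by simp
  also have "\<dots> < r I" using n C_pos by (simp add: field_simps)
  finally have "C * (1/2) ^ Suc n < r I" .
  from LeastI[of "\<lambda>n. C * (1/2) ^ Suc n < r I", OF this]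
  show "C * (1/2) ^ bucket I / 2 < r I" by (simp add: bucket_def)
  show "r I \<le> C * (1/2) ^ bucket I"
  proof (cases "bucket I")
    case 0
    have "C * L ^ length I \<le> C * 1" using C_pos L by (intro mult_left_mono power_le_one) auto
    then show ?thesis using decay[OF I] 0 by simp
  next
    case (Suc k)
    then have "\<not> C * (1/2) ^ Suc k < r I"
      using not_less_Least[of k "\<lambda>n. C * (1/2) ^ Suc n < r I"] by (simp add: bucket_def)
    then show ?thesis using Suc by simp
  qed
qed

lemma geometric_sum_le: "0 \<le> x \<Longrightarrow> x < 1 \<Longrightarrow> (\<Sum>n<p. x ^ n) \<le> 1 / (1 - x)" for x :: real
  by (simp add: sum_gp_strict divide_right_mono)

text \<open>Writing \<open>t = u + 2 \<delta>\<close>, one factor \<open>r\<^sup>\<delta>\<close> decays geometrically in the bucket index and the other in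
  the word length, so bounded bucket sums for \<open>u\<close> would make the series for \<open>t\<close> converge.\<close>

lemma exists_large_bucket:
  assumes "u < t" and ns: "\<not> (\<lambda>I. r I powr t) summable_on words m"
  shows "\<exists>k n. B < (\<Sum>I\<in>{I \<in> words m. length I = k \<and> bucket I = n}. r I powr u)"
proof (rule ccontr)
  assume neg: "\<not> ?thesis"
  define \<delta> where "\<delta> = (t - u) / 2"
  have \<delta>: "0 < \<delta>" using assms by (simp add: \<delta>_def)
  define x where "x = (1/2) powr \<delta>"
  define y where "y = L powr \<delta>"
  define Q where "Q = B * (C powr \<delta> * C powr \<delta>)"
  have xy: "0 \<le> x" "x < 1" "0 \<le> y" "y < 1"
    using powr_less_mono2[OF \<delta>, of "1/2" 1] powr_less_mono2[OF \<delta>, of L 1] L by (auto simp: x_def y_def)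
  have fibre: "(\<Sum>I\<in>{I \<in> words m. length I = k \<and> bucket I = n}. r I powr t) \<le> Q * (x ^ n * y ^ k)" for k n
  proof -
    have "r I powr t \<le> r I powr u * (C powr \<delta> * C powr \<delta> * (x ^ n * y ^ k))"
      if "I \<in> {I \<in> words m. length I = k \<and> bucket I = n}" for I
    proof -
      from that have I: "I \<in> words m" "length I = k" "bucket I = n" by auto
      have "r I powr \<delta> \<le> (C * (1/2) ^ n) powr \<delta>"
        using bucket(2)[OF I(1)] I r_pos[OF I(1)] \<delta> by (intro powr_mono2) auto
      also have "\<dots> = C powr \<delta> * x ^ n"
        using C_pos by (simp add: x_def powr_mult powr_realpow[symmetric] powr_powr mult.commute)
      finally have 1: "r I powr \<delta> \<le> C powr \<delta> * x ^ n" .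
      have "r I powr \<delta> \<le> (C * L ^ k) powr \<delta>"
        using decay[OF I(1)] I r_pos[OF I(1)] \<delta> by (intro powr_mono2) auto
      also have "\<dots> = C powr \<delta> * y ^ k"
        using C_pos L by (simp add: y_def powr_mult powr_realpow[symmetric] powr_powr mult.commute)
      finally have 2: "r I powr \<delta> \<le> C powr \<delta> * y ^ k" .
      have "t = u + (\<delta> + \<delta>)" by (simp add: \<delta>_def field_simps)
      then have "r I powr t = r I powr u * (r I powr \<delta> * r I powr \<delta>)" by (simp only: powr_add)
      also have "\<dots> \<le> r I powr u * ((C powr \<delta> * x ^ n) * (C powr \<delta> * y ^ k))"
        using 1 2 xy by (intro mult_left_mono mult_mono) auto
      finally show ?thesis by (simp add: mult_ac)
    qed
    then have "(\<Sum>I\<in>{I \<in> words m. length I = k \<and> bucket I = n}. r I powr t)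
       \<le> (\<Sum>I\<in>{I \<in> words m. length I = k \<and> bucket I = n}. r I powr u * (C powr \<delta> * C powr \<delta> * (x ^ n * y ^ k)))"
      by (rule sum_mono)
    also have "\<dots> = (\<Sum>I\<in>{I \<in> words m. length I = k \<and> bucket I = n}. r I powr u) * (C powr \<delta> * C powr \<delta> * (x ^ n * y ^ k))"
      by (simp add: sum_distrib_right)
    also have "\<dots> \<le> B * (C powr \<delta> * C powr \<delta> * (x ^ n * y ^ k))"
      using neg xy by (intro mult_right_mono) (auto simp: not_less)
    finally show ?thesis by (simp add: Q_def mult_ac)
  qed
  have B: "0 \<le> B"
  proof -
    have "(\<Sum>I\<in>{I \<in> words m. length I = 0 \<and> bucket I = 0}. r I powr u) \<le> B" using neg unfolding not_ex not_less by blast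
    moreover have "0 \<le> (\<Sum>I\<in>{I \<in> words m. length I = 0 \<and> bucket I = 0}. r I powr u)" by (intro sum_nonneg) auto
    ultimately show ?thesis by linarith
  qed
  then have Q: "0 \<le> Q" by (simp add: Q_def)
  have "(\<lambda>I. r I powr t) summable_on words m"
  proof (rule nonneg_bdd_above_summable_on)
    show "bdd_above (sum (\<lambda>I. r I powr t) ` {F. F \<subseteq> words m \<and> finite F})"
    proof (rule bdd_aboveI2)
      fix F assume "F \<in> {F. F \<subseteq> words m \<and> finite F}"
      then have F: "F \<subseteq> words m" "finite F" by auto
      \<comment> \<open>A common strict bound for the finitely many lengths and bucket indices in
        \<open>F\<close>, which reduces the sum to a product of two truncated geometric
        series.\<close>
      define p where "p = Suc (Max (insert 0 (length ` F \<union> bucket ` F)))"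
      have p: "length I < p \<and> bucket I < p" if "I \<in> F" for I
        unfolding p_def less_Suc_eq_le using F that by (intro conjI Max_ge) auto
      have "sum (\<lambda>I. r I powr t) F = (\<Sum>q\<in>{..<p} \<times> {..<p}. \<Sum>I\<in>{I \<in> F. (length I, bucket I) = q}. r I powr t)"
        using F p by (intro sum.group[symmetric]) auto
      also have "\<dots> \<le> (\<Sum>q\<in>{..<p} \<times> {..<p}. Q * (x ^ snd q * y ^ fst q))"
      proof (rule sum_mono)
        fix q :: "nat \<times> nat"
        have "(\<Sum>I\<in>{I \<in> F. (length I, bucket I) = q}. r I powr t)
          \<le> (\<Sum>I\<in>{I \<in> words m. length I = fst q \<and> bucket I = snd q}. r I powr t)"
          using F by (intro sum_mono2 finite_subset[OF _ finite_words_length[of m "fst q"]]) auto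
        then show "(\<Sum>I\<in>{I \<in> F. (length I, bucket I) = q}. r I powr t) \<le> Q * (x ^ snd q * y ^ fst q)"
          using fibre[of "fst q" "snd q"] by linarith
      qed
      also have "\<dots> = Q * ((\<Sum>k<p. y ^ k) * (\<Sum>n<p. x ^ n))"
        by (simp add: sum_product sum.cartesian_product sum_distrib_left case_prod_beta mult_ac)
      also have "\<dots> \<le> Q * (1 / (1 - y) * (1 / (1 - x)))"
        using Q xy by (intro mult_left_mono mult_mono geometric_sum_le sum_nonneg) auto
      finally show "sum (\<lambda>I. r I powr t) F \<le> Q * (1 / (1 - y) * (1 / (1 - x)))" .
    qed
  qed simp
  with ns show False by simp
qed

lemma comp_seq_word_map:
  "comp_seq (\<lambda>I. word_map \<psi> (I @ J)) \<omega> n = word_map \<psi> (concat (map (\<lambda>i. \<omega> i @ J) [0..<n]))"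
  by (induction n) (simp_all add: word_map_append)

text \<open>The word \<open>J\<close> pushes the constructed points into \<open>X\<close>: for the closed residual set any letter will
  do, for the open one \<open>J\<close> must map the closure of \<open>V\<close> into \<open>V\<close>.\<close>

lemma hausdorff_measure_pos_residual:
  assumes u: "0 \<le> u" "u < t" and ns: "\<not> (\<lambda>I. r I powr t) summable_on words m"
    and J: "J \<in> words m" "J \<noteq> []"
    and X: "\<And>i. i \<in> {1..m} \<Longrightarrow> \<psi> i ` X \<subseteq> X" "word_map \<psi> J ` closure V \<subseteq> X"
  shows "hausdorff_measure u (residual_set m \<psi> X) \<noteq> 0"
proof -
  \<comment> \<open>By \<open>lower\<close>, applied to \<open>I\<close> and to \<open>J\<close>,
    together with \<open>r I > \<tau> / 2\<close>, the map of \<open>I @ J\<close> shrinks distances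
    by a factor of at least \<open>b * \<tau>\<close>.\<close>
  define b where "b = c * (c * r J) / 2"
  have b: "0 < b" using c r_pos[OF J(1)] by (simp add: b_def)
  define N' where "N' = max 1 (real N)"
  then have N': "0 < N'" by simp
  \<comment> \<open>The factor \<open>N'\<close> pays for passing to disjoint images. The two
    summands then guarantee the inequalities \<open>E2\<close> and \<open>E1\<close>, one for each
    alternative in the minimum defining \<open>a\<close>.\<close>
  define B where "B = N' * (b powr (- u) + (2 * C) powr u)"
  obtain k n where kn: "B < (\<Sum>I\<in>{I \<in> words m. length I = k \<and> bucket I = n}. r I powr u)"
    using exists_large_bucket[OF u(2) ns] by blast
  define D where "D = {I \<in> words m. length I = k \<and> bucket I = n}"
  define \<tau> where "\<tau> = C * (1/2) ^ n"
  have \<tau>: "0 < \<tau>" "\<tau> \<le> C" using C_pos by (auto simp: \<tau>_def mult_le_cancel_left1 power_le_one)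
  have Dsub: "D \<subseteq> {I \<in> words m. length I = k}" by (auto simp: D_def)
  have finD: "finite D" using finite_subset[OF Dsub finite_words_length] .
  have Dr: "\<tau> / 2 < r I \<and> r I \<le> \<tau>" if "I \<in> D" for I
    using bucket[of I] that by (auto simp: D_def \<tau>_def)
  obtain E where E: "E \<subseteq> D" "card D \<le> N * card E"
    "\<And>I J. I \<in> E \<Longrightarrow> J \<in> E \<Longrightarrow> I \<noteq> J \<Longrightarrow> \<not> word_map \<psi> I ` closure V \<inter> word_map \<psi> J ` closure V \<noteq> {}"
  proof (rule independent_subset[of D "\<lambda>I J. word_map \<psi> I ` closure V \<inter> word_map \<psi> J ` closure V \<noteq> {}" N])
    show "card {J \<in> D. word_map \<psi> I ` closure V \<inter> word_map \<psi> J ` closure V \<noteq> {}} \<le> N" if "I \<in> D" for I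
      using overlap[OF Dsub _ that, of \<tau>] Dr by blast
  qed (use finD V in auto)
  have "B < card D * \<tau> powr u"
  proof -
    have "(\<Sum>I\<in>D. r I powr u) \<le> (\<Sum>I\<in>D. \<tau> powr u)"
      using Dr r_pos u by (intro sum_mono powr_mono2) (auto simp: D_def less_imp_le)
    then show ?thesis using kn by (simp add: D_def)
  qed
  also have "\<dots> \<le> N' * card E * \<tau> powr u"
  proof (rule mult_right_mono)
    have "real (card D) \<le> real N * real (card E)" using E(2) by (metis of_nat_le_iff of_nat_mult)
    also have "\<dots> \<le> N' * card E" by (intro mult_right_mono) (auto simp: N'_def)
    finally show "real (card D) \<le> N' * card E" .
  qed simp
  finally have big: "b powr (- u) + (2 * C) powr u < card E * \<tau> powr u"
    unfolding B_def mult.assoc using N' by simp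
  \<comment> \<open>The minimum with 1/2 ensures \<open>a < 1\<close>, as the strong separation
    lemma requires.\<close>
  define a where "a = min (1/2) (b * \<tau>)"
  have a: "0 < a" "a < 1" using b \<tau> by (auto simp: a_def)
  have E1: "1 \<le> card E * (1/2) powr u"
  proof -
    have "(2 * C) powr u \<le> card E * \<tau> powr u" using big by (smt (verit) powr_ge_zero)
    also have "\<dots> \<le> card E * C powr u" using \<tau> u by (intro mult_left_mono powr_mono2) auto
    finally have "2 powr u \<le> card E" using C_pos by (simp add: powr_mult)
    then show ?thesis by (simp add: powr_divide)
  qed
  have E2: "1 \<le> card E * (b * \<tau>) powr u"
  proof -
    have "b powr (- u) \<le> card E * \<tau> powr u" using big by (smt (verit) powr_ge_zero)
    then have "b powr u * b powr (- u) \<le> b powr u * (card E * \<tau> powr u)" by (intro mult_left_mono) auto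
    then show ?thesis using b \<tau> by (simp add: powr_mult powr_add[symmetric] mult_ac)
  qed
  have Ea: "1 \<le> card E * a powr u" using E1 E2 by (auto simp: a_def min_def)
  have EW: "I @ J \<in> words m" if "I \<in> E" for I using that E(1) J by (auto simp: D_def)
  have into: "word_map \<psi> (I @ J) ` closure V \<subseteq> closure V" if "I \<in> E" for I
    by (rule word_maps_closure[OF EW[OF that]])
  show ?thesis
  proof (rule hausdorff_measure_pos[where K = "closure V" and E = E and h = "\<lambda>I. word_map \<psi> (I @ J)" and a = a])
    show "finite E" using finite_subset[OF E(1) finD] .
    show "E \<noteq> {}" using Ea by auto
    show "continuous_on (closure V) (word_map \<psi> (I @ J))" if "I \<in> E" for I
    proof (rule lipschitz_on_continuous_on)
      show "(C * r (I @ J))-lipschitz_on (closure V) (word_map \<psi> (I @ J))"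
        using upper[OF EW[OF that]] C_pos r_pos[OF EW[OF that]] by (intro lipschitz_onI) auto
    qed
    show "disjoint_family_on (\<lambda>I. word_map \<psi> (I @ J) ` closure V) E"
      unfolding disjoint_family_on_def
    proof (intro ballI impI)
      fix I I' assume I: "I \<in> E" "I' \<in> E" "I \<noteq> I'"
      have "word_map \<psi> (I @ J) ` closure V \<subseteq> word_map \<psi> I ` closure V" for I
        unfolding word_map_append image_comp[symmetric] by (intro image_mono word_maps_closure J(1))
      then show "word_map \<psi> (I @ J) ` closure V \<inter> word_map \<psi> (I' @ J) ` closure V = {}"
        using E(3)[OF I] by (meson disjoint_iff subsetD)
    qed
    show "a * dist x y \<le> dist (word_map \<psi> (I @ J) x) (word_map \<psi> (I @ J) y)"
      if I: "I \<in> E" and xy: "x \<in> closure V" "y \<in> closure V" for I x y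
    proof -
      have IW: "I \<in> words m" "I \<in> D"
        using EW[OF I] subsetD[OF E(1) I] by simp_all
      have Jxy: "word_map \<psi> J x \<in> closure V" "word_map \<psi> J y \<in> closure V"
        using word_maps_closure[OF J(1)] xy by (meson imageI subsetD)+
      have "a * dist x y \<le> b * \<tau> * dist x y" by (intro mult_right_mono) (auto simp: a_def)
      also have "\<dots> = c * (\<tau> / 2) * (c * r J * dist x y)" by (simp add: b_def)
      also have "\<dots> \<le> c * r I * dist (word_map \<psi> J x) (word_map \<psi> J y)"
        using lower[OF J(1) xy] Dr[OF IW(2)] c \<tau> r_pos[OF J(1)] r_pos[OF IW(1)]
        by (intro mult_mono mult_left_mono) auto
      also have "\<dots> \<le> dist (word_map \<psi> I (word_map \<psi> J x)) (word_map \<psi> I (word_map \<psi> J y))"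
        by (rule lower[OF IW(1) Jxy])
      finally show ?thesis by (simp add: word_map_append)
    qed
    show "x \<in> residual_set m \<psi> X"
      if w: "\<forall>i. \<omega> i \<in> E" and x: "\<forall>n. x \<in> comp_seq (\<lambda>I. word_map \<psi> (I @ J)) \<omega> n ` closure V" for \<omega> x
    proof (rule word_map_mem_residual[OF X(1)])
      fix n
      define W where "W = concat (map (\<lambda>i. \<omega> i @ J) [0..<n])"
      have W: "W \<in> words m \<and> n \<le> length W" unfolding W_def
      proof (induction n)
        case (Suc n)
        have "1 \<le> length J" using J(2) by (cases J) auto
        then show ?case using Suc EW[OF spec[OF w, of n]] by auto
      qed simp
      have \<omega>n: "\<omega> n \<in> words m" using EW[OF spec[OF w, of n]] by simp
      \<comment> \<open>At depth \<open>n + 1\<close> the last \<open>J\<close> is split off and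
        used to carry the closure of \<open>V\<close> into \<open>X\<close>; the remaining word
        still has length at least \<open>n\<close>, because each earlier block contains the nonempty
        \<open>J\<close>.\<close>
      have "x \<in> word_map \<psi> (W @ (\<omega> n @ J)) ` closure V"
        using x[rule_format, of "Suc n"] unfolding comp_seq_word_map W_def by simp
      then have "x \<in> word_map \<psi> (W @ \<omega> n) ` (word_map \<psi> J ` closure V)"
        unfolding word_map_append image_comp o_assoc .
      then have "x \<in> word_map \<psi> (W @ \<omega> n) ` X" using X(2) by blast
      then show "\<exists>W\<in>words m. n \<le> length W \<and> x \<in> word_map \<psi> W ` X"
        using W \<omega>n by (intro bexI[of _ "W @ \<omega> n"]) auto
    qed
  qed (use V compact into a u Ea in auto)
qed

text \<open>A point of the open residual set lies in \<open>V\<close> with a ball around it. The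
  cylinders containing the point shrink to it, so a sufficiently long one fits into that
  ball.\<close>

lemma exists_word_into_V:
  assumes "residual_set m \<psi> V \<noteq> {}"
  obtains J where "J \<in> words m" "J \<noteq> []" "word_map \<psi> J ` closure V \<subseteq> V"
proof -
  obtain x where x: "x \<in> residual_set m \<psi> V" using assms by blast
  have lev: "\<exists>I\<in>words m. length I = k \<and> x \<in> word_map \<psi> I ` V" if "1 \<le> k" for k
  proof -
    have "x \<in> (\<Union>I\<in>{I \<in> words m. length I = k}. word_map \<psi> I ` V)"
      using x that unfolding residual_set_def by (meson INT_D atLeast_iff)
    then show ?thesis by blast
  qed
  have sub: "word_map \<psi> W ` V \<subseteq> V" if "W \<in> words m" for W
    using maps(1) that by (rule word_map_image_subset)
  have "x \<in> V" using lev[of 1] sub by auto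
  then obtain e where e: "0 < e" "ball x e \<subseteq> V" using V(1) open_contains_ball by metis
  define d where "d = C * diameter (closure V)"
  have d: "0 \<le> d" using C_pos diameter_ge_0[OF compact_imp_bounded[OF compact]] by (simp add: d_def)
  have "(\<lambda>k. d * (C * L ^ k)) \<longlonglongrightarrow> d * (C * 0)"
    using L by (intro tendsto_intros LIMSEQ_realpow_zero) auto
  then have "\<forall>\<^sub>F k in sequentially. d * (C * L ^ k) < e"
    using e by (intro order_tendstoD(2)) auto
  then have "\<forall>\<^sub>F k in sequentially. d * (C * L ^ k) < e \<and> 1 \<le> k"
    using eventually_ge_at_top[of 1] by eventually_elim simp
  then obtain k where k: "d * (C * L ^ k) < e" "1 \<le> k"
    by (metis (mono_tags, lifting) eventually_sequentially order_refl)
  obtain J where J: "J \<in> words m" "length J = k" "x \<in> word_map \<psi> J ` V" using lev[OF k(2)] by blast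
  obtain v where v: "v \<in> V" "x = word_map \<psi> J v" using J(3) by blast
  have "word_map \<psi> J ` closure V \<subseteq> V"
  proof clarify
    fix y assume y: "y \<in> closure V"
    have "v \<in> closure V" using v(1) closure_subset by blast
    then have "dist x (word_map \<psi> J y) \<le> diameter (word_map \<psi> J ` closure V)"
      unfolding v(2) using y by (intro diameter_bounded_bound diameter_word(1) J(1)) auto
    also have "\<dots> \<le> d * r J" using diameter_word(2)[OF J(1)] by (simp add: d_def mult_ac)
    also have "\<dots> \<le> d * (C * L ^ k)" using decay[OF J(1)] J(2) d by (intro mult_left_mono) auto
    finally have "word_map \<psi> J y \<in> ball x e" using k by simp
    then show "word_map \<psi> J y \<in> V" using e by blast
  qed
  moreover have "J \<noteq> []" using J(2) k(2) by auto
  ultimately show ?thesis using that J(1) by blast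
qed

end

subsection \<open>Charts of the projective line\<close>

lemma norm_le_sum_vec2: "norm v \<le> cmod (v $ 1) + cmod (v $ 2)" for v :: "complex ^ 2"
  unfolding norm_vec_def by (rule order_trans[OF L2_set_le_sum]) (auto simp: sum_2)

lemma norm_matrix_vector_le:
  fixes M :: "complex ^ 2 ^ 2"
  obtains g where "0 < g" "\<And>v. norm (M *v v) \<le> g * norm v" "\<And>v i. cmod ((M *v v) $ i) \<le> g * norm v"
proof
  define g where "g = 1 + 4 * max_norm M"
  show "0 < g" using max_norm_nonneg[of M] by (simp add: g_def)
  have row: "cmod ((M *v v) $ i) \<le> 2 * max_norm M * norm v" for v i
  proof -
    have "cmod ((M *v v) $ i) \<le> cmod (M $ i $ 1) * cmod (v $ 1) + cmod (M $ i $ 2) * cmod (v $ 2)"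
      by (simp add: matrix_vector_mult_def sum_2 norm_mult[symmetric] norm_triangle_ineq)
    also have "\<dots> \<le> max_norm M * norm v + max_norm M * norm v"
      by (intro add_mono mult_mono max_norm_ge max_norm_nonneg Finite_Cartesian_Product.norm_nth_le norm_ge_zero)
    finally show ?thesis by simp
  qed
  show "norm (M *v v) \<le> g * norm v" for v
    using norm_le_sum_vec2[of "M *v v"] row[of v 1] row[of v 2] norm_ge_zero[of v]
    by (simp only: g_def distrib_right mult.assoc mult_1)
  show "cmod ((M *v v) $ i) \<le> g * norm v" for v i
  proof -
    have "0 \<le> max_norm M * norm v" using max_norm_nonneg[of M] by simp
    then show ?thesis using row[of v i] norm_ge_zero[of v]
      unfolding g_def distrib_right mult.assoc mult_1 by linarith
  qed
qed

lemma matrix_inv_right: "invertible M \<Longrightarrow> M ** matrix_inv M = mat 1"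
  and matrix_inv_left: "invertible M \<Longrightarrow> matrix_inv M ** M = mat 1"
  unfolding invertible_def matrix_inv_def by (metis (mono_tags, lifting) someI_ex)+

lemma invertible_mult_vec_nonzero:
  fixes M :: "complex ^ 2 ^ 2"
  assumes "invertible M" "v \<noteq> 0" shows "M *v v \<noteq> 0"
  using assms by (metis invertible_def matrix_vector_mul_assoc matrix_vector_mul_lid matrix_vector_mult_0_right)

lemma chart_abs:
  assumes "v \<noteq> 0"
  shows "abs_cp1 v \<in> chart_domain B \<longleftrightarrow> (B *v v) $ 2 \<noteq> 0"
    and "chart B (abs_cp1 v) = (B *v v) $ 1 / (B *v v) $ 2"
proof -
  obtain c where c: "c \<noteq> 0" "rep_cp1 (abs_cp1 v) = c *s v" using rep_abs_cp1[OF assms] .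
  have "(B *v (c *s v)) $ i = c * (B *v v) $ i" for i
    by (simp add: matrix_vector_mult_def sum_2 algebra_simps)
  then show "abs_cp1 v \<in> chart_domain B \<longleftrightarrow> (B *v v) $ 2 \<noteq> 0"
    and "chart B (abs_cp1 v) = (B *v v) $ 1 / (B *v v) $ 2"
    using c by (simp_all add: chart_domain_def chart_def)
qed

lemma chart_diff:
  assumes "v \<noteq> 0" "w \<noteq> 0" "abs_cp1 v \<in> chart_domain B" "abs_cp1 w \<in> chart_domain B"
  shows "cmod (chart B (abs_cp1 v) - chart B (abs_cp1 w)) =
    cmod (det B) * cmod (det2 v w) / (cmod ((B *v v) $ 2) * cmod ((B *v w) $ 2))"
proof -
  have "chart B (abs_cp1 v) - chart B (abs_cp1 w) = det2 (B *v v) (B *v w) / ((B *v v) $ 2 * (B *v w) $ 2)"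
    using assms by (simp add: chart_abs det2_def diff_frac_eq mult.commute)
  then show ?thesis by (simp add: det2_mult norm_divide norm_mult)
qed

lemma chart_surj:
  assumes "invertible B"
  obtains p where "p \<in> chart_domain B" "chart B p = z"
proof -
  define e :: "complex ^ 2" where "e = vector [z, 1]"
  have e: "e $ 1 = z" "e $ 2 = 1" by (simp_all add: e_def)
  define v where "v = matrix_inv B *v e"
  have Bv: "B *v v = e"
    using assms by (simp add: v_def matrix_vector_mul_assoc matrix_inv_right)
  then have "v \<noteq> 0" using e by (metis matrix_vector_mult_0_right zero_index zero_neq_one)
  then show ?thesis using that[of "abs_cp1 v"] by (simp add: chart_abs Bv e)
qed

text \<open>Valid on the whole chart domain, since the denominator of the chart is at most a
  constant times the norm of the representative. The reverse estimate needs distance from the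
  pole.\<close>

lemma dist_le_chart:
  assumes "invertible B"
  obtains C where "0 < C" "\<And>p q. p \<in> chart_domain B \<Longrightarrow> q \<in> chart_domain B \<Longrightarrow>
    dist p q \<le> C * cmod (chart B p - chart B q)"
proof -
  obtain g where g: "0 < g" "\<And>v i. cmod ((B *v v) $ i) \<le> g * norm v" using norm_matrix_vector_le[of B] by metis
  have dB: "0 < cmod (det B)" using assms by (simp add: invertible_det_nz)
  show ?thesis
  proof (rule that[of "pi * (g * g) / cmod (det B)"])
    show "0 < pi * (g * g) / cmod (det B)" using g dB by simp
    fix p q assume pq: "p \<in> chart_domain B" "q \<in> chart_domain B"
    obtain v where v: "v \<noteq> 0" "p = abs_cp1 v" by (rule cp1_cases)
    obtain w where w: "w \<noteq> 0" "q = abs_cp1 w" by (rule cp1_cases)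
    define x where "x = cmod ((B *v v) $ 2)"
    define y where "y = cmod ((B *v w) $ 2)"
    have xy: "0 < x" "0 < y" using pq v w by (auto simp: chart_abs x_def y_def)
    have n: "0 < norm v" "0 < norm w" using v w by auto
    have "dist p q \<le> pi * (cmod (det2 v w) / (norm v * norm w))" using dist_abs_cp1(2) v w by simp
    also have "cmod (det2 v w) / (norm v * norm w) = (cmod (det2 v w) / (x * y)) * ((x / norm v) * (y / norm w))"
      using xy by simp
    also have "\<dots> \<le> (cmod (det2 v w) / (x * y)) * (g * g)"
      using xy g n by (intro mult_left_mono mult_mono) (auto simp: x_def y_def divide_le_eq)
    also have "cmod (det2 v w) / (x * y) = cmod (chart B p - chart B q) / cmod (det B)"
      using pq v w dB by (simp add: chart_diff x_def y_def)
    finally show "dist p q \<le> pi * (g * g) / cmod (det B) * cmod (chart B p - chart B q)"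
      by (simp add: mult_ac)
  qed
qed

text \<open>A closed set inside the chart domain stays at a positive distance from the pole of the
  chart, which bounds the denominator of the chart away from zero.\<close>

lemma chart_le_dist:
  assumes B: "invertible B" and S: "closed S" "S \<subseteq> chart_domain B"
  obtains c where "0 < c" "\<And>p q. p \<in> S \<Longrightarrow> q \<in> S \<Longrightarrow> c * cmod (chart B p - chart B q) \<le> dist p q"
proof -
  have dB: "0 < cmod (det B)" using B by (simp add: invertible_det_nz)
  define e where "e = matrix_inv B *v axis 1 1"
  have Be: "B *v e = axis 1 1"
    using B by (simp add: e_def matrix_vector_mul_assoc matrix_inv_right)
  then have e0: "e \<noteq> 0" by (metis axis_eq_0_iff matrix_vector_mult_0_right zero_neq_one)
  have "abs_cp1 e \<notin> S" using S e0 by (auto simp: chart_abs Be axis_def)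
  then obtain \<delta> where \<delta>: "0 < \<delta>" "ball (abs_cp1 e) \<delta> \<subseteq> - S"
    using S(1) by (meson ComplI closed_def open_contains_ball)
  have far: "\<delta> \<le> dist (abs_cp1 e) p" if "p \<in> S" for p
    using subsetD[OF \<delta>(2), of p] that by force
  define g where "g = cmod (det B) * (\<delta> * norm e) / pi"
  have g: "0 < g" using dB \<delta> e0 by (simp add: g_def)
  have low: "g * norm v \<le> cmod ((B *v v) $ 2)" if v: "v \<noteq> 0" "abs_cp1 v \<in> S" for v
  proof -
    have "det2 (B *v e) (B *v v) = (B *v v) $ 2" by (simp add: Be det2_def axis_def)
    then have *: "cmod ((B *v v) $ 2) = cmod (det B) * cmod (det2 e v)" by (metis det2_mult norm_mult)
    have "\<delta> \<le> pi * (cmod (det2 e v) / (norm e * norm v))"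
      using far[OF v(2)] dist_abs_cp1(2)[OF e0 v(1)] by linarith
    then have "\<delta> * norm e * norm v / pi \<le> cmod (det2 e v)" using e0 v by (simp add: field_simps)
    then have "cmod (det B) * (\<delta> * norm e * norm v / pi) \<le> cmod ((B *v v) $ 2)"
      unfolding * by (rule mult_left_mono) simp
    then show ?thesis by (simp add: g_def mult_ac)
  qed
  show ?thesis
  proof (rule that[of "2 * (g * g) / cmod (det B)"])
    show "0 < 2 * (g * g) / cmod (det B)" using g dB by simp
    fix p q assume pq: "p \<in> S" "q \<in> S"
    obtain v where v: "v \<noteq> 0" "p = abs_cp1 v" by (rule cp1_cases)
    obtain w where w: "w \<noteq> 0" "q = abs_cp1 w" by (rule cp1_cases)
    define x where "x = cmod ((B *v v) $ 2)"
    define y where "y = cmod ((B *v w) $ 2)"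
    have xy: "g * norm v \<le> x" "g * norm w \<le> y" using low v w pq by (simp_all add: x_def y_def)
    have n: "0 < norm v" "0 < norm w" using v w by auto
    have pos: "0 < x" "0 < y"
      using xy g n by (smt (verit) mult_pos_pos)+
    have "2 * (g * g) / cmod (det B) * cmod (chart B p - chart B q) = 2 * ((g * g) * (cmod (det2 v w) / (x * y)))"
      using pq S v w dB by (subst v, subst w, subst chart_diff) (auto simp: x_def y_def)
    also have "(g * g) * (cmod (det2 v w) / (x * y)) \<le> ((x / norm v) * (y / norm w)) * (cmod (det2 v w) / (x * y))"
      using xy g n pos by (intro mult_right_mono mult_mono) (auto simp: le_divide_eq)
    also have "\<dots> = cmod (det2 v w) / (norm v * norm w)" using pos by simp
    also have "2 * \<dots> \<le> dist p q" using dist_abs_cp1(1) v w by simp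
    finally show "2 * (g * g) / cmod (det B) * cmod (chart B p - chart B q) \<le> dist p q" by simp
  qed
qed

lemma inj_on_chart: "invertible B \<Longrightarrow> inj_on (chart B) (chart_domain B)"
  by (rule inj_onI) (metis dist_le_chart diff_self norm_zero mult_zero_right dist_le_zero_iff)

lemma in_chart_eq:
  "invertible B \<Longrightarrow> p \<in> chart_domain B \<Longrightarrow> in_chart B g (chart B p) = chart B (g p)"
  by (simp add: in_chart_def inv_into_f_f inj_on_chart)

lemma induced_map_matrix:
  assumes v: "v \<noteq> 0"
    and f: "Vector_Spaces.linear (*s) (*s) f" "inj f" "\<And>u. f u = G *v u"
  shows "induced_map f (abs_cp1 v) = abs_cp1 (G *v v)"
  using induced_map_abs[OF f(1,2) v] f(3) by simp

text \<open>Linear automorphisms act by Lipschitz maps: \<open>det2\<close> is multiplied by the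
  determinant and norms shrink at most by a factor controlled by the inverse matrix. Continuity
  passes invariance from \<open>V\<close> to its closure.\<close>

lemma continuous_induced_map:
  assumes G: "invertible G" and f: "Vector_Spaces.linear (*s) (*s) f" "inj f" "\<And>u. f u = G *v u"
  shows "continuous_on S (induced_map f)"
proof -
  obtain g where g: "0 < g" "\<And>v. norm (matrix_inv G *v v) \<le> g * norm v"
    using norm_matrix_vector_le[of "matrix_inv G"] by metis
  define k where "k = pi / 2 * (cmod (det G) * (g * g))"
  have k: "0 \<le> k" using g by (simp add: k_def)
  have "k-lipschitz_on S (induced_map f)"
  proof (rule lipschitz_onI[OF _ k])
    fix p q
    obtain v where v: "v \<noteq> 0" "p = abs_cp1 v" by (rule cp1_cases)
    obtain w where w: "w \<noteq> 0" "q = abs_cp1 w" by (rule cp1_cases)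
    have G0: "G *v v \<noteq> 0" "G *v w \<noteq> 0" using invertible_mult_vec_nonzero[OF G] v w by auto
    have ni: "norm u / norm (G *v u) \<le> g" if "G *v u \<noteq> 0" for u
      using g(2)[of "G *v u"] G that by (simp add: matrix_vector_mul_assoc matrix_inv_left divide_le_eq)
    have n: "0 < norm v" "0 < norm w" using v w by auto
    have "dist (induced_map f p) (induced_map f q) \<le> pi * (cmod (det2 (G *v v) (G *v w)) / (norm (G *v v) * norm (G *v w)))"
      using dist_abs_cp1(2)[OF G0] v w f by (simp add: induced_map_matrix[OF _ f])
    also have "cmod (det2 (G *v v) (G *v w)) / (norm (G *v v) * norm (G *v w))
        = cmod (det G) * (cmod (det2 v w) / (norm v * norm w)) * ((norm v / norm (G *v v)) * (norm w / norm (G *v w)))"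
      using n by (simp add: det2_mult norm_mult)
    also have "\<dots> \<le> cmod (det G) * (cmod (det2 v w) / (norm v * norm w)) * (g * g)"
      using ni[OF G0(1)] ni[OF G0(2)] g by (intro mult_left_mono mult_mono) auto
    also have "\<dots> \<le> cmod (det G) * (dist p q / 2) * (g * g)"
    proof -
      have "cmod (det2 v w) / (norm v * norm w) \<le> dist p q / 2"
        using dist_abs_cp1(1)[OF v(1) w(1)] unfolding v(2) w(2) by linarith
      then show ?thesis using g by (intro mult_right_mono mult_left_mono) auto
    qed
    finally show "dist (induced_map f p) (induced_map f q) \<le> k * dist p q"
      by (simp add: k_def mult_ac)
  qed
  then show ?thesis by (rule lipschitz_on_continuous_on)
qed

subsection \<open>Separation of cylinders and the critical exponent\<close>

text \<open>Counting in a square grid of side \<open>\<sigma> * \<tau> / 2\<close>: two points in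
  one cell would be closer than \<open>\<sigma> * \<tau>\<close>. The scale \<open>\<tau>\<close>
  cancels, so the number of available cells depends on \<open>R\<close> and \<open>\<sigma>\<close>
  only.\<close>

lemma card_separated_le:
  fixes f :: "'i \<Rightarrow> complex"
  assumes pos: "0 < \<sigma>" "0 < \<tau>"
    and near: "\<And>i. i \<in> D \<Longrightarrow> cmod (f i - z) \<le> R * \<tau>"
    and sep: "\<And>i j. i \<in> D \<Longrightarrow> j \<in> D \<Longrightarrow> i \<noteq> j \<Longrightarrow> \<sigma> * \<tau> \<le> cmod (f i - f j)"
  shows "card D \<le> card ({- \<lceil>2 * R / \<sigma>\<rceil> - 1..\<lceil>2 * R / \<sigma>\<rceil>} \<times> {- \<lceil>2 * R / \<sigma>\<rceil> - 1..\<lceil>2 * R / \<sigma>\<rceil>})"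
proof -
  define s where "s = \<sigma> * \<tau> / 2"
  have s: "0 < s" using pos by (simp add: s_def)
  define G where "G i = (\<lfloor>Re (f i - z) / s\<rfloor>, \<lfloor>Im (f i - z) / s\<rfloor>)" for i
  have close: "\<bar>x - y\<bar> < s" if "\<lfloor>x / s\<rfloor> = \<lfloor>y / s\<rfloor>" for x y
  proof -
    have "\<bar>x / s - y / s\<bar> < 1" using that by linarith
    then have "\<bar>(x - y) / s\<bar> < 1" by (simp add: diff_divide_distrib)
    then show ?thesis using s by (simp add: abs_divide)
  qed
  have range: "\<lfloor>x / s\<rfloor> \<in> {- \<lceil>2 * R / \<sigma>\<rceil> - 1..\<lceil>2 * R / \<sigma>\<rceil>}" if "\<bar>x\<bar> \<le> R * \<tau>" for x
  proof -
    have "\<bar>x\<bar> / s \<le> R * \<tau> / s" using that s by (simp add: divide_right_mono)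
    also have "R * \<tau> / s = 2 * R / \<sigma>" using pos by (simp add: s_def)
    finally have "\<bar>x / s\<bar> \<le> 2 * R / \<sigma>" using s by (simp add: abs_divide)
    then show ?thesis by (simp only: atLeastAtMost_iff) linarith
  qed
  show ?thesis
  proof (rule card_inj_on_le[of G])
    show "inj_on G D"
    proof (rule inj_onI, rule ccontr)
      fix i j assume ij: "i \<in> D" "j \<in> D" "G i = G j" "i \<noteq> j"
      have "\<lfloor>Re (f i - z) / s\<rfloor> = \<lfloor>Re (f j - z) / s\<rfloor>" "\<lfloor>Im (f i - z) / s\<rfloor> = \<lfloor>Im (f j - z) / s\<rfloor>"
        using ij(3) unfolding G_def by (simp_all only: prod.inject)
      from this[THEN close]
      have "\<bar>Re (f i - z) - Re (f j - z)\<bar> < s" "\<bar>Im (f i - z) - Im (f j - z)\<bar> < s" .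
      then have "\<bar>Re (f i - f j)\<bar> + \<bar>Im (f i - f j)\<bar> < \<sigma> * \<tau>" by (simp add: s_def)
      then show False using sep[OF ij(1,2,4)] cmod_le[of "f i - f j"] by linarith
    qed
    show "G ` D \<subseteq> {- \<lceil>2 * R / \<sigma>\<rceil> - 1..\<lceil>2 * R / \<sigma>\<rceil>} \<times> {- \<lceil>2 * R / \<sigma>\<rceil> - 1..\<lceil>2 * R / \<sigma>\<rceil>}"
    proof
      fix y assume "y \<in> G ` D"
      then obtain i where i: "i \<in> D" "y = G i" by blast
      have "\<bar>Re (f i - z)\<bar> \<le> R * \<tau>" "\<bar>Im (f i - z)\<bar> \<le> R * \<tau>"
        using near[OF i(1)] abs_Re_le_cmod[of "f i - z"] abs_Im_le_cmod[of "f i - z"] by linarith+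
      then show "y \<in> {- \<lceil>2 * R / \<sigma>\<rceil> - 1..\<lceil>2 * R / \<sigma>\<rceil>} \<times> {- \<lceil>2 * R / \<sigma>\<rceil> - 1..\<lceil>2 * R / \<sigma>\<rceil>}"
        unfolding i G_def using range by blast
    qed
  qed simp
qed

text \<open>Common initial letters are cancelled by injectivity; at the first differing letter the
  open set condition separates the images.\<close>

lemma word_images_disjoint:
  assumes inj: "\<And>i. i \<in> {1..m} \<Longrightarrow> inj_on (\<psi> i) V"
    and disj: "disjoint_family_on (\<lambda>i. \<psi> i ` V) {1..m}"
    and maps: "\<And>i. i \<in> {1..m} \<Longrightarrow> \<psi> i ` V \<subseteq> V"
    and "I \<in> words m" "J \<in> words m" "length I = length J" "I \<noteq> J"
  shows "word_map \<psi> I ` V \<inter> word_map \<psi> J ` V = {}"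
  using assms(4-7)
proof (induction I arbitrary: J)
  case (Cons i I)
  then obtain j J' where J: "J = j # J'" by (cases J) auto
  have sub: "word_map \<psi> W ` V \<subseteq> V" if "W \<in> words m" for W
    using maps that by (rule word_map_image_subset)
  have ij: "i \<in> {1..m}" "j \<in> {1..m}" "I \<in> words m" "J' \<in> words m" using Cons.prems by (auto simp: J)
  have eq: "word_map \<psi> (i # I) ` V = \<psi> i ` (word_map \<psi> I ` V)" "word_map \<psi> J ` V = \<psi> j ` (word_map \<psi> J' ` V)"
    by (simp_all add: J image_comp)
  show ?case
  proof (cases "i = j")
    case True
    then have "word_map \<psi> I ` V \<inter> word_map \<psi> J' ` V = {}"
      using Cons ij by (intro Cons.IH) (auto simp: J)
    then show ?thesis
      unfolding True eq(1)[unfolded True] eq(2)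
      using inj_on_image_Int[OF inj[OF ij(2)] sub[OF ij(3)] sub[OF ij(4)]] by simp
  next
    case False
    have "\<psi> i ` V \<inter> \<psi> j ` V = {}" using disjoint_family_onD[OF disj ij(1,2) False] .
    moreover have "\<psi> i ` (word_map \<psi> I ` V) \<subseteq> \<psi> i ` V" "\<psi> j ` (word_map \<psi> J' ` V) \<subseteq> \<psi> j ` V"
      using sub ij by (auto intro!: image_mono)
    ultimately show ?thesis unfolding eq by blast
  qed
qed simp

text \<open>Links the extended real sum in the definition of the exponent with summability of reals,
  on which the estimates operate.\<close>

lemma infsum_ennreal_eq_top_iff:
  fixes f :: "'i \<Rightarrow> real"
  assumes "\<And>x. x \<in> A \<Longrightarrow> 0 \<le> f x"
  shows "(\<Sum>\<^sub>\<infinity>x\<in>A. ennreal (f x)) = \<infinity> \<longleftrightarrow> \<not> f summable_on A"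
proof
  assume top: "(\<Sum>\<^sub>\<infinity>x\<in>A. ennreal (f x)) = \<infinity>"
  show "\<not> f summable_on A"
  proof
    assume sm: "f summable_on A"
    have "(\<Sum>\<^sub>\<infinity>x\<in>A. ennreal (f x)) \<le> ennreal (infsum f A)"
      unfolding nonneg_infsum_complete[OF zero_le]
    proof (rule SUP_least)
      fix F assume "F \<in> {F. finite F \<and> F \<subseteq> A}"
      then have F: "finite F" "F \<subseteq> A" by auto
      have "(\<Sum>x\<in>F. ennreal (f x)) = ennreal (sum f F)" using assms F by (intro sum_ennreal) auto
      also have "\<dots> \<le> ennreal (infsum f A)"
        using F assms sm by (intro ennreal_leI finite_sum_le_infsum) auto
      finally show "(\<Sum>x\<in>F. ennreal (f x)) \<le> ennreal (infsum f A)" .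
    qed
    then show False unfolding top by (simp add: top_unique)
  qed
next
  assume ns: "\<not> f summable_on A"
  show "(\<Sum>\<^sub>\<infinity>x\<in>A. ennreal (f x)) = \<infinity>"
  proof (rule ccontr)
    assume fin: "(\<Sum>\<^sub>\<infinity>x\<in>A. ennreal (f x)) \<noteq> \<infinity>"
    define b where "b = enn2real (\<Sum>\<^sub>\<infinity>x\<in>A. ennreal (f x))"
    have b: "(\<Sum>\<^sub>\<infinity>x\<in>A. ennreal (f x)) = ennreal b" "0 \<le> b" using fin by (auto simp: b_def less_top)
    have "f summable_on A"
    proof (rule nonneg_bdd_above_summable_on)
      show "bdd_above (sum f ` {F. F \<subseteq> A \<and> finite F})"
      proof (rule bdd_aboveI2)
        fix F assume "F \<in> {F. F \<subseteq> A \<and> finite F}"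
        then have F: "F \<subseteq> A" "finite F" by auto
        have "ennreal (sum f F) = (\<Sum>x\<in>F. ennreal (f x))" using assms F by (intro sum_ennreal[symmetric]) auto
        also have "\<dots> \<le> ennreal b"
          unfolding b(1)[symmetric] nonneg_infsum_complete[OF zero_le] using F by (intro SUP_upper) auto
        finally show "sum f F \<le> b" using b(2) by (simp add: ennreal_le_iff)
      qed
    qed (rule assms)
    with ns show False by simp
  qed
qed

text \<open>Both sides are thresholds in the exponent, and \<open>summ\<close> matches them with a
  factor 2 because \<open>r I\<close> behaves like the inverse square of the matrix norm.\<close>

lemma hausdorff_dim_eq_exponent:
  fixes r :: "nat list \<Rightarrow> real"
  assumes summ: "\<And>t. 0 \<le> t \<Longrightarrow> (\<lambda>I. r I powr t) summable_on words m \<longleftrightarrow>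
      (\<Sum>\<^sub>\<infinity>I\<in>words m. ennreal (max_norm (word_matrix A I) powr (- (2 * t)))) \<noteq> \<infinity>"
    and up: "\<And>t. 0 < t \<Longrightarrow> (\<lambda>I. r I powr t) summable_on words m \<Longrightarrow> hausdorff_measure t X = 0"
    and low: "\<And>u t. 0 \<le> u \<Longrightarrow> u < t \<Longrightarrow> \<not> (\<lambda>I. r I powr t) summable_on words m \<Longrightarrow> hausdorff_measure u X \<noteq> 0"
  shows "2 * hausdorff_dim X = semigroup_exponent m A"
proof (rule antisym)
  show "2 * hausdorff_dim X \<le> semigroup_exponent m A"
  proof (rule ccontr)
    assume "\<not> 2 * hausdorff_dim X \<le> semigroup_exponent m A"
    \<comment> \<open>A value strictly between the two sides is finite and positive; the series
      converges there, so the measure at half of it vanishes and bounds the dimension.\<close>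
    then obtain y where y: "semigroup_exponent m A < y" "y < 2 * hausdorff_dim X"
      using dense by (metis not_le)
    then have "y < top" by (metis order_less_le_trans top_greatest)
    then obtain x where x: "0 \<le> x" "y = ennreal x" by (cases y) auto
    have "0 < x" using y(1) x by (metis ennreal_0 less_eq_real_def not_less_zero)
    have "(\<Sum>\<^sub>\<infinity>I\<in>words m. ennreal (max_norm (word_matrix A I) powr (- x))) \<noteq> \<infinity>"
    proof
      assume "(\<Sum>\<^sub>\<infinity>I\<in>words m. ennreal (max_norm (word_matrix A I) powr (- x))) = \<infinity>"
      then have "ennreal x \<le> semigroup_exponent m A"
        unfolding semigroup_exponent_def using x by (intro Sup_upper) auto
      then show False using y x by simp
    qed
    then have "hausdorff_measure (x / 2) X = 0"
      using summ[of "x / 2"] \<open>0 < x\<close> by (intro up) auto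
    then have "hausdorff_dim X \<le> ennreal (x / 2)"
      unfolding hausdorff_dim_def using x by (intro Inf_lower) auto
    then have "2 * hausdorff_dim X \<le> 2 * ennreal (x / 2)" by (rule mult_left_mono) simp
    also have "\<dots> = y" using x ennreal_mult'[of 2 "x / 2"] by simp
    finally show False using y by simp
  qed
  show "semigroup_exponent m A \<le> 2 * hausdorff_dim X"
    unfolding semigroup_exponent_def
  proof (rule Sup_least, clarify)
    fix s :: real assume s: "0 \<le> s" "(\<Sum>\<^sub>\<infinity>I\<in>words m. ennreal (max_norm (word_matrix A I) powr (- s))) = \<infinity>"
    have ns: "\<not> (\<lambda>I. r I powr (s / 2)) summable_on words m" using summ[of "s / 2"] s by simp
    have "ennreal (s / 2) \<le> hausdorff_dim X"
      unfolding hausdorff_dim_def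
    proof (rule Inf_greatest, clarify)
      fix u :: real assume u: "0 \<le> u" "hausdorff_measure u X = 0"
      then have "s / 2 \<le> u" using low[OF u(1) _ ns] by force
      then show "ennreal (s / 2) \<le> ennreal u" by (rule ennreal_leI)
    qed
    then have "2 * ennreal (s / 2) \<le> 2 * hausdorff_dim X" by (rule mult_left_mono) simp
    then show "ennreal s \<le> 2 * hausdorff_dim X" using s ennreal_mult'[of 2 "s / 2"] by simp
  qed
qed

subsection \<open>The projective system\<close>

text \<open>In homogeneous coordinates \<open>B *v (G *v v)\<close> equals
  \<open>M *v (B *v v)\<close>. Dividing by the second coordinate of \<open>B *v v\<close> yields
  numerator and denominator of the Moebius map of \<open>M\<close>.\<close>

lemma chart_induced_map:
  assumes G: "invertible G" "Vector_Spaces.linear (*s) (*s) f" "inj f" "\<And>u. f u = G *v u"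
    and BG: "B ** G = M ** B" and p: "p \<in> chart_domain B"
  shows "induced_map f p \<in> chart_domain B \<longleftrightarrow> mden M (chart B p) \<noteq> 0"
    and "chart B (induced_map f p) = mob M (chart B p)"
proof -
  obtain v where v: "v \<noteq> 0" "p = abs_cp1 v" by (rule cp1_cases)
  define x where "x = B *v v"
  have x: "x $ 2 \<noteq> 0" "chart B p = x $ 1 / x $ 2" using p v by (auto simp: chart_abs x_def)
  have q: "induced_map f p = abs_cp1 (G *v v)" "G *v v \<noteq> 0"
    using induced_map_matrix[OF v(1) G(2-4)] v invertible_mult_vec_nonzero[OF G(1)] by auto
  have "B *v (G *v v) = M *v x" by (simp add: x_def matrix_vector_mul_assoc BG)
  then have "(B *v (G *v v)) $ 2 = x $ 2 * mden M (chart B p)" "(B *v (G *v v)) $ 1 = x $ 2 * mnum M (chart B p)"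
    using x by (simp_all add: mden_def mnum_def matrix_vector_mult_def sum_2 field_simps)
  then show "induced_map f p \<in> chart_domain B \<longleftrightarrow> mden M (chart B p) \<noteq> 0"
    and "chart B (induced_map f p) = mob M (chart B p)"
    using x q by (simp_all add: chart_abs mob_def)
qed

text \<open>Conjugation telescopes along a word, so a single constant serves words of every
  length.\<close>

lemma max_norm_word_conj:
  assumes Q: "Q ** Q' = mat 1" "Q' ** Q = mat 1"
  obtains h where "0 < h" "\<And>I. max_norm (word_matrix (\<lambda>i. Q ** A i ** Q') I) \<le> h * max_norm (word_matrix A I)"
    "\<And>I. max_norm (word_matrix A I) \<le> h * max_norm (word_matrix (\<lambda>i. Q ** A i ** Q') I)"
proof -
  have two: "max_norm (X ** Y ** Z) \<le> (1 + 4 * (max_norm X * max_norm Z)) * max_norm Y" for X Y Z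
  proof -
    have "max_norm (X ** Y ** Z) \<le> 2 * (max_norm (X ** Y) * max_norm Z)" by (rule max_norm_mult)
    also have "\<dots> \<le> 2 * ((2 * (max_norm X * max_norm Y)) * max_norm Z)"
      by (intro mult_left_mono mult_right_mono max_norm_mult max_norm_nonneg) simp
    finally show ?thesis using max_norm_nonneg[of Y] by (simp add: algebra_simps)
  qed
  show ?thesis
  proof (rule that[of "1 + 4 * (max_norm Q * max_norm Q')"])
    show "0 < 1 + 4 * (max_norm Q * max_norm Q')"
      using max_norm_nonneg[of Q] max_norm_nonneg[of Q'] by (simp add: add_pos_nonneg)
    fix I
    note conj = word_matrix_conj[OF Q, of A I]
    show "max_norm (word_matrix (\<lambda>i. Q ** A i ** Q') I) \<le> (1 + 4 * (max_norm Q * max_norm Q')) * max_norm (word_matrix A I)"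
      unfolding conj by (rule two)
    have "Q' ** word_matrix (\<lambda>i. Q ** A i ** Q') I ** Q = (Q' ** Q) ** word_matrix A I ** (Q' ** Q)"
      unfolding conj by (simp add: matrix_mul_assoc)
    then have "word_matrix A I = Q' ** word_matrix (\<lambda>i. Q ** A i ** Q') I ** Q" using Q by simp
    then show "max_norm (word_matrix A I) \<le> (1 + 4 * (max_norm Q * max_norm Q')) * max_norm (word_matrix (\<lambda>i. Q ** A i ** Q') I)"
      using two[of Q' "word_matrix (\<lambda>i. Q ** A i ** Q') I" Q] by (simp add: mult.commute)
  qed
qed

lemma hausdorff_measure_mono:
  assumes "X \<subseteq> Y" shows "hausdorff_measure s X \<le> hausdorff_measure s Y"
  unfolding hausdorff_measure_def hausdorff_premeasure_def
  by (intro SUP_mono' Inf_superset_mono) (use assms in blast)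

text \<open>The chart is bi-Lipschitz on the closure of \<open>V\<close>, so the estimates for
  Moebius words transfer to the projective line. A change of basis costs only constants, which lets
  \<open>r\<close> be expressed through the given matrices \<open>A\<close>.\<close>

lemma projective_conformal_ifs:
  fixes A :: "nat \<Rightarrow> complex ^ 2 ^ 2"
  assumes automorphisms:
      "\<And>i. i \<in> {1..m} \<Longrightarrow> Vector_Spaces.linear (*s) (*s) (f i) \<and> bij (f i)"
    and coordinates: "invertible P"
      "\<And>i v. i \<in> {1..m} \<Longrightarrow> f i (P *v v) = P *v (A i *v v)"
    and SL2: "\<And>i. i \<in> {1..m} \<Longrightarrow> det (A i) = 1"
    and V: "open V" "V \<noteq> {}"
    and OSC: "open_set_condition m (\<lambda>i. induced_map (f i)) V"
    and chart: "invertible B" "closure V \<subseteq> chart_domain B"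
    and contractions: "\<And>i. i \<in> {1..m} \<Longrightarrow>
      \<exists>L<1. L-lipschitz_on (chart B ` closure V) (in_chart B (induced_map (f i)))"
  shows "\<exists>c C L N. conformal_ifs m (\<lambda>i. induced_map (f i)) V (\<lambda>I. 1 / (max_norm (word_matrix A I))\<^sup>2) c C L N"
proof -

  \<comment> \<open>Matrices of the maps in the chart\<close>
  define \<psi> where "\<psi> = (\<lambda>i. induced_map (f i))"
  define Q where "Q = B ** P"
  define Q' where "Q' = matrix_inv Q"
  have invQ: "invertible Q" unfolding Q_def by (intro invertible_mult chart coordinates)
  have QQ: "Q ** Q' = mat 1" "Q' ** Q = mat 1"
    using invQ by (simp_all add: Q'_def matrix_inv_left matrix_inv_right)
  \<comment> \<open>\<open>Q\<close> passes from the coordinates in which \<open>A i\<close>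
    represents \<open>f i\<close> to those of the chart, so \<open>M i\<close> is the matrix whose
    Moebius map is \<open>f i\<close> in the chart.\<close>
  define M where "M = (\<lambda>i. Q ** A i ** Q')"
  define G where "G i = P ** A i ** matrix_inv P" for i
  have PP: "P ** matrix_inv P = mat 1" "matrix_inv P ** P = mat 1"
    using coordinates by (simp_all add: matrix_inv_left matrix_inv_right)
  have invG: "invertible (G i)" if "i \<in> {1..m}" for i
  proof -
    have "invertible (A i)" using SL2[OF that] by (simp add: invertible_det_nz)
    moreover have "invertible (matrix_inv P)" unfolding invertible_def using PP by blast
    ultimately show ?thesis unfolding G_def by (intro invertible_mult coordinates)
  qed
  have fG: "f i u = G i *v u" if "i \<in> {1..m}" for i u
  proof -
    have "u = P *v (matrix_inv P *v u)" by (simp add: matrix_vector_mul_assoc PP)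
    then show ?thesis
      using coordinates(2)[OF that, of "matrix_inv P *v u"] by (simp add: G_def matrix_vector_mul_assoc matrix_mul_assoc)
  qed
  have lin: "Vector_Spaces.linear (*s) (*s) (f i)" "inj (f i)" if "i \<in> {1..m}" for i
    using automorphisms[OF that] by (auto simp: bij_def)
  have BG: "B ** G i = M i ** B" for i
  proof -
    have "Q' ** B = Q' ** B ** (P ** matrix_inv P)" by (simp add: PP)
    also have "\<dots> = (Q' ** Q) ** matrix_inv P" by (simp only: Q_def matrix_mul_assoc)
    finally have "Q' ** B = matrix_inv P" by (simp add: QQ)
    then have "M i ** B = Q ** A i ** matrix_inv P" by (simp add: M_def matrix_mul_assoc[symmetric])
    then show ?thesis by (simp add: G_def Q_def matrix_mul_assoc)
  qed
  have cmap: "\<psi> i p \<in> chart_domain B \<longleftrightarrow> mden (M i) (chart B p) \<noteq> 0" "chart B (\<psi> i p) = mob (M i) (chart B p)"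
    if "i \<in> {1..m}" "p \<in> chart_domain B" for i p
    unfolding \<psi>_def using chart_induced_map[OF invG lin fG BG] that by blast+
  have maps_V: "\<psi> i ` V \<subseteq> V" if "i \<in> {1..m}" for i
    using OSC that by (auto simp: open_set_condition_def \<psi>_def)
  have disj: "disjoint_family_on (\<lambda>i. \<psi> i ` V) {1..m}" using OSC by (simp add: open_set_condition_def \<psi>_def)
  have maps_cl: "\<psi> i ` closure V \<subseteq> closure V" if "i \<in> {1..m}" for i
  proof (rule image_closure_subset)
    show "continuous_on (closure V) (\<psi> i)"
      unfolding \<psi>_def by (rule continuous_induced_map[OF invG lin fG]) (rule that)+
    show "\<psi> i ` V \<subseteq> closure V" using maps_V[OF that] closure_subset by blast
  qed simp

  \<comment> \<open>The chart images of \<open>V\<close> and its closure\<close>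
  define U where "U = chart B ` V"
  define K where "K = chart B ` closure V"
  obtain c where c: "0 < c" "\<And>p q. p \<in> closure V \<Longrightarrow> q \<in> closure V \<Longrightarrow> c * cmod (chart B p - chart B q) \<le> dist p q"
    using chart_le_dist[OF chart(1) closed_closure chart(2)] by metis
  obtain C where C: "0 < C" "\<And>p q. p \<in> chart_domain B \<Longrightarrow> q \<in> chart_domain B \<Longrightarrow> dist p q \<le> C * cmod (chart B p - chart B q)"
    using dist_le_chart[OF chart(1)] by metis
  have Vcl: "V \<subseteq> closure V" by (rule closure_subset)
  have compact: "compact (closure V)" using closed_Int_compact[OF closed_closure compact_cp1, of V] by simp
  define \<Delta> where "\<Delta> = diameter (closure V) / c"
  have K_diam: "cmod (z - w) \<le> \<Delta>" if zw: "z \<in> K" "w \<in> K" for z w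
  proof -
    obtain p q where pq: "p \<in> closure V" "q \<in> closure V" "z = chart B p" "w = chart B q"
      using zw by (auto simp: K_def)
    have "c * cmod (z - w) \<le> diameter (closure V)"
      using c(2)[OF pq(1,2)] diameter_bounded_bound[OF compact_imp_bounded[OF compact] pq(1,2)] pq by simp
    then show ?thesis using c by (simp add: \<Delta>_def field_simps)
  qed
  have "open U"
    unfolding open_dist
  proof
    fix z assume "z \<in> U"
    then obtain p where p: "p \<in> V" "z = chart B p" by (auto simp: U_def)
    obtain e where e: "0 < e" "ball p e \<subseteq> V" using V(1) p by (meson open_contains_ball)
    show "\<exists>e>0. \<forall>w. dist w z < e \<longrightarrow> w \<in> U"
    proof (intro exI[of _ "e / C"] conjI allI impI)
      show "0 < e / C" using e C by simp
      fix w assume w: "dist w z < e / C"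
      \<comment> \<open>Openness relies on the chart being onto the complex plane: a nearby
        \<open>w\<close> has a preimage, and \<open>dist_le_chart\<close> places it in
        \<open>V\<close>.\<close>
      obtain q where q: "q \<in> chart_domain B" "chart B q = w" using chart_surj[OF chart(1)] .
      have "dist p q \<le> C * cmod (chart B p - chart B q)" using C(2) q p Vcl chart(2) by blast
      also have "\<dots> < e" using w C p q by (simp add: dist_norm norm_minus_commute field_simps)
      finally have "q \<in> V" using e by auto
      then show "w \<in> U" using q by (auto simp: U_def)
    qed
  qed
  have "K \<subseteq> closure U"
  proof
    fix z assume "z \<in> K"
    then obtain p where p: "p \<in> closure V" "z = chart B p" by (auto simp: K_def)
    show "z \<in> closure U"
      unfolding closure_approachable
    proof (intro allI impI)
      fix e :: real assume e: "0 < e"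
      then have "0 < c * e" using c by simp
      then obtain q where q: "q \<in> V" "dist q p < c * e" using p(1) unfolding closure_approachable by blast
      have "c * cmod (chart B q - chart B p) < c * e"
        using c(2)[of q p] q p Vcl by force
      then have "dist (chart B q) z < e" using c p by (simp add: dist_norm)
      then show "\<exists>y\<in>U. dist y z < e" using q by (auto simp: U_def)
    qed
  qed
  obtain p0 where p0: "p0 \<in> V" using V by blast
  define z0 where "z0 = chart B p0"
  have z0: "z0 \<in> U" "z0 \<in> K" using p0 Vcl by (auto simp: z0_def U_def K_def)
  have "bounded K"
  proof (rule boundedI)
    fix z assume "z \<in> K"
    then show "cmod z \<le> cmod z0 + \<Delta>"
      using K_diam[OF _ z0(2), of z] norm_triangle_sub[of z z0] by linarith
  qed

  \<comment> \<open>The Moebius system with a common contraction ratio\<close>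
  obtain l where l: "\<And>i. i \<in> {1..m} \<Longrightarrow> l i < 1 \<and> (l i)-lipschitz_on K (in_chart B (\<psi> i))"
    using contractions unfolding K_def \<psi>_def by metis
  \<comment> \<open>The inserted 1/2 makes the common ratio positive.\<close>
  define L where "L = Max (insert (1/2) (l ` {1..m}))"
  have L: "0 < L" "L < 1" "\<And>i. i \<in> {1..m} \<Longrightarrow> l i \<le> L"
  proof -
    have "1/2 \<le> L" unfolding L_def by (intro Max_ge) auto
    then show "0 < L" by simp
    show "L < 1" unfolding L_def using l by (subst Max_less_iff) auto
    show "l i \<le> L" if "i \<in> {1..m}" for i unfolding L_def using that by (intro Max_ge) auto
  qed
  interpret mobius_ifs m M U K L
  proof
    show "det (M i) = 1" if "i \<in> {1..m}" for i
    proof -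
      have "det Q * det Q' = 1" using QQ by (metis det_I det_mul)
      then show ?thesis using SL2[OF that] by (simp add: M_def det_mul)
    qed
    show "open U" "K \<subseteq> closure U" "bounded K" "0 < L" "L < 1" by fact+
    show "U \<subseteq> K" using Vcl by (auto simp: U_def K_def)
    fix i z assume i: "i \<in> {1..m}" and z: "z \<in> K"
    obtain p where p: "p \<in> closure V" "z = chart B p" using z by (auto simp: K_def)
    have pd: "p \<in> chart_domain B" using p chart by blast
    have img: "\<psi> i p \<in> closure V" using maps_cl[OF i] p by blast
    then show "mden (M i) z \<noteq> 0" using cmap(1)[OF i pd] p chart(2) by auto
    show "mob (M i) z \<in> K" unfolding K_def p(2) cmap(2)[OF i pd, symmetric] using img by (rule imageI)
    have ic: "in_chart B (\<psi> i) z = mob (M i) z"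
      unfolding p(2) in_chart_eq[OF chart(1) pd] cmap(2)[OF i pd] ..
    fix w assume w: "w \<in> K"
    obtain q where q: "q \<in> closure V" "w = chart B q" using w by (auto simp: K_def)
    have qd: "q \<in> chart_domain B" using q chart by blast
    have ic': "in_chart B (\<psi> i) w = mob (M i) w"
      unfolding q(2) in_chart_eq[OF chart(1) qd] cmap(2)[OF i qd] ..
    have "cmod (mob (M i) z - mob (M i) w) \<le> l i * cmod (z - w)"
      using lipschitz_onD[OF conjunct2[OF l[OF i]] z w] by (simp add: ic ic' dist_norm)
    also have "\<dots> \<le> L * cmod (z - w)" using L(3)[OF i] by (intro mult_right_mono) auto
    finally show "cmod (mob (M i) z - mob (M i) w) \<le> L * cmod (z - w)" .
  qed
  have word: "word_map \<psi> I p \<in> closure V \<and> chart B (word_map \<psi> I p) = mob (N I) (chart B p)"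
    if "I \<in> words m" "p \<in> closure V" for I p
    using that(1)
  proof (induction I)
    case (Cons i I)
    then have i: "i \<in> {1..m}" and I: "I \<in> words m" and IH: "word_map \<psi> I p \<in> closure V" "chart B (word_map \<psi> I p) = mob (N I) (chart B p)"
      by auto
    have "chart B p \<in> K" using that by (simp add: K_def)
    then have "mden (N I) (chart B p) \<noteq> 0" using den_nz[OF I] by blast
    moreover have "\<psi> i (word_map \<psi> I p) \<in> closure V" using maps_cl[OF i] IH(1) by blast
    moreover have "word_map \<psi> I p \<in> chart_domain B" using IH chart by blast
    ultimately show ?case using cmap(2)[OF i] IH(2) by (simp add: mob_mult)
  qed (use that in simp)

  \<comment> \<open>Denominators, matrix norms and distances\<close>
  define a where "a I = max_norm (word_matrix A I)" for I
  define r where "r = (\<lambda>I. 1 / (max_norm (word_matrix A I))\<^sup>2)"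
  have r: "r I = 1 / (a I)\<^sup>2" for I by (simp add: r_def a_def)
  have a_pos: "0 < a I" if "I \<in> words m" for I
    unfolding a_def using det_word_matrix[of m A I] SL2 that by (intro max_norm_pos) auto
  have r_pos: "0 < r I" if "I \<in> words m" for I using a_pos[OF that] by (simp add: r)
  obtain h where h: "0 < h" "\<And>I. max_norm (N I) \<le> h * a I" "\<And>I. a I \<le> h * max_norm (N I)"
    using max_norm_word_conj[OF QQ, of A] unfolding a_def M_def by metis
  obtain C1 where C1: "1 \<le> C1" "\<And>I z. I \<in> words m \<Longrightarrow> z \<in> K \<Longrightarrow>
    max_norm (N I) \<le> C1 * cmod (mden (N I) z) \<and> cmod (mden (N I) z) \<le> C1 * max_norm (N I)"
    using den_max_norm by metis
  \<comment> \<open>The change of basis constant times the distortion constant.\<close>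
  define H where "H = h * C1"
  have H: "0 < H" using h C1 by (simp add: H_def)
  have den_a: "cmod (mden (N I) z) \<le> H * a I" "a I \<le> H * cmod (mden (N I) z)"
    if "I \<in> words m" "z \<in> K" for I z
  proof -
    have "cmod (mden (N I) z) \<le> C1 * (h * a I)"
      using C1(2)[OF that] mult_left_mono[OF h(2)[of I], of C1] C1(1) by linarith
    then show "cmod (mden (N I) z) \<le> H * a I" by (simp add: H_def mult_ac)
    have "a I \<le> h * (C1 * cmod (mden (N I) z))"
      using h(3)[of I] mult_left_mono[OF conjunct1[OF C1(2)[OF that]], of h] h(1) by linarith
    then show "a I \<le> H * cmod (mden (N I) z)" by (simp add: H_def mult_ac)
  qed
  have inv_den: "r I / H\<^sup>2 \<le> 1 / (cmod (mden (N I) z) * cmod (mden (N I) w))"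
    "1 / (cmod (mden (N I) z) * cmod (mden (N I) w)) \<le> H\<^sup>2 * r I"
    if "I \<in> words m" "z \<in> K" "w \<in> K" for I z w
  proof -
    define x where "x = cmod (mden (N I) z)"
    define y where "y = cmod (mden (N I) w)"
    have pos: "0 < x" "0 < y" "0 < a I" using den_nz that a_pos by (auto simp: x_def y_def)
    have "x * y \<le> (H * a I) * (H * a I)"
      using den_a(1)[OF that(1,2)] den_a(1)[OF that(1,3)] pos H by (intro mult_mono) (auto simp: x_def y_def)
    then have "1 / ((H * a I) * (H * a I)) \<le> 1 / (x * y)" using pos H by (intro divide_left_mono) auto
    then show "r I / H\<^sup>2 \<le> 1 / (cmod (mden (N I) z) * cmod (mden (N I) w))"
      by (simp add: r x_def y_def power2_eq_square mult_ac)
    have "a I * a I \<le> (H * x) * (H * y)"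
      using den_a(2)[OF that(1,2)] den_a(2)[OF that(1,3)] pos H by (intro mult_mono) (auto simp: x_def y_def)
    then have "1 / (x * y) \<le> H\<^sup>2 * r I" using pos by (simp add: r field_simps power2_eq_square)
    then show "1 / (cmod (mden (N I) z) * cmod (mden (N I) w)) \<le> H\<^sup>2 * r I" by (simp add: x_def y_def)
  qed
  have mob_dist: "r I / H\<^sup>2 * cmod (z - w) \<le> cmod (mob (N I) z - mob (N I) w)"
    "cmod (mob (N I) z - mob (N I) w) \<le> H\<^sup>2 * r I * cmod (z - w)"
    if I: "I \<in> words m" and z: "z \<in> K" and w: "w \<in> K" for I z w
  proof -
    have "mob (N I) z - mob (N I) w = (z - w) / (mden (N I) z * mden (N I) w)"
      using det1 by (intro mob_diff den_nz I z w det_word_matrix[of m]) auto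
    then have *: "cmod (mob (N I) z - mob (N I) w) = 1 / (cmod (mden (N I) z) * cmod (mden (N I) w)) * cmod (z - w)"
      by (simp add: norm_divide norm_mult)
    show "r I / H\<^sup>2 * cmod (z - w) \<le> cmod (mob (N I) z - mob (N I) w)"
      "cmod (mob (N I) z - mob (N I) w) \<le> H\<^sup>2 * r I * cmod (z - w)"
      unfolding * by (intro mult_right_mono inv_den[OF I z w] norm_ge_zero)+
  qed
  have chK: "chart B p \<in> K" if "p \<in> closure V" for p using that by (simp add: K_def)
  have lower: "c / (H\<^sup>2 * C) * r I * dist p q \<le> dist (word_map \<psi> I p) (word_map \<psi> I q)"
    if I: "I \<in> words m" and p: "p \<in> closure V" and q: "q \<in> closure V" for I p q
  proof -
    have "c / (H\<^sup>2 * C) * r I * dist p q \<le> c / (H\<^sup>2 * C) * r I * (C * cmod (chart B p - chart B q))"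
      using c C H r_pos[OF I] p q chart by (intro mult_left_mono C(2)) auto
    also have "\<dots> = c * (r I / H\<^sup>2 * cmod (chart B p - chart B q))" using C by simp
    also have "\<dots> \<le> c * cmod (mob (N I) (chart B p) - mob (N I) (chart B q))"
      using c by (intro mult_left_mono mob_dist I chK p q) auto
    also have "\<dots> \<le> dist (word_map \<psi> I p) (word_map \<psi> I q)"
      using c(2) word[OF I p] word[OF I q] by metis
    finally show ?thesis .
  qed
  have upper: "dist (word_map \<psi> I p) (word_map \<psi> I q) \<le> C * H\<^sup>2 / c * r I * dist p q"
    if I: "I \<in> words m" and p: "p \<in> closure V" and q: "q \<in> closure V" for I p q
  proof -
    have "dist (word_map \<psi> I p) (word_map \<psi> I q) \<le> C * cmod (mob (N I) (chart B p) - mob (N I) (chart B q))"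
      using C(2) word[OF I p] word[OF I q] chart(2) by (metis subsetD)
    also have "\<dots> \<le> C * (H\<^sup>2 * r I * cmod (chart B p - chart B q))"
      using C by (intro mult_left_mono mob_dist I chK p q) auto
    also have "\<dots> = C * H\<^sup>2 / c * r I * (c * cmod (chart B p - chart B q))" using c by simp
    also have "\<dots> \<le> C * H\<^sup>2 / c * r I * dist p q"
      using c C r_pos[OF I] p q by (intro mult_left_mono c(2)) auto
    finally show ?thesis .
  qed
  \<comment> \<open>A second point of \<open>K\<close> gives a positive distance to divide by when
    the lower distance bound is compared with the geometric contraction of words.\<close>
  obtain z1 where z1: "z1 \<in> K" "z1 \<noteq> z0"
  proof -
    have "z0 islimpt U" using islimpt_closure_open[OF \<open>open U\<close> refl, of z0] z0 closure_subset[of U] by (auto simp: limpt_of_closure)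
    then obtain z1 where "z1 \<in> U" "z1 \<noteq> z0" by (metis islimptE open_UNIV UNIV_I)
    then show ?thesis using that U by blast
  qed
  have decay: "r I \<le> H\<^sup>2 * L ^ length I" if I: "I \<in> words m" for I
  proof -
    have "r I / H\<^sup>2 * cmod (z1 - z0) \<le> L ^ length I * cmod (z1 - z0)"
      using mob_dist(1)[OF I z1(1) z0(2)] word_contraction[OF I z1(1) z0(2)] by linarith
    then have "r I / H\<^sup>2 \<le> L ^ length I" by (rule mult_right_le_imp_le) (use z1 in simp)
    then show ?thesis using H by (simp add: field_simps)
  qed

  \<comment> \<open>Bounded overlap from the open set condition\<close>
  obtain \<eta> where \<eta>: "0 < \<eta>" "\<And>I w. I \<in> words m \<Longrightarrow>
    cmod (w - mob (N I) z0) < \<eta> / (cmod (mden (N I) z0))\<^sup>2 \<Longrightarrow> w \<in> mob (N I) ` U"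
    using image_ball[OF z0(1)] by metis
  have inj: "inj_on (\<psi> i) V" if "i \<in> {1..m}" for i
  proof (rule inj_onI)
    fix p q assume pq: "p \<in> V" "q \<in> V" "\<psi> i p = \<psi> i q"
    have I: "[i] \<in> words m" using that by simp
    have "c / (H\<^sup>2 * C) * r [i] * dist p q \<le> 0"
      using lower[OF I, of p q] pq Vcl by auto
    moreover have "0 < c / (H\<^sup>2 * C) * r [i]" using c H C r_pos[OF I] by simp
    ultimately have "dist p q \<le> 0" by (meson mult_pos_pos not_le)
    then show "p = q" by simp
  qed
  \<comment> \<open>For \<open>r J > \<tau> / 2\<close> the ball that \<open>image_ball\<close>
    places in the image of \<open>U\<close> under \<open>J\<close> has radius at least
    \<open>\<sigma> * \<tau>\<close>. \<open>R\<close> reflects that base points of two intersecting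
    cylinders are joined through a common point, each within
    \<open>H\<^sup>2 * \<tau> * \<Delta>\<close> of it.\<close>
  define \<sigma> where "\<sigma> = \<eta> / (2 * H\<^sup>2)"
  define R where "R = 2 * (H\<^sup>2 * \<Delta>)"
  define n where "n = card ({- \<lceil>2 * R / \<sigma>\<rceil> - 1..\<lceil>2 * R / \<sigma>\<rceil>} \<times> {- \<lceil>2 * R / \<sigma>\<rceil> - 1..\<lceil>2 * R / \<sigma>\<rceil>})"
  have overlap: "card {J \<in> D. word_map \<psi> I ` closure V \<inter> word_map \<psi> J ` closure V \<noteq> {}} \<le> n"
    if D: "D \<subseteq> {I \<in> words m. length I = k}" and \<tau>: "\<forall>I\<in>D. \<tau> / 2 < r I \<and> r I \<le> \<tau>" and I: "I \<in> D" for k \<tau> D I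
    unfolding n_def
  proof (rule card_separated_le[where \<tau> = \<tau> and f = "\<lambda>J. mob (N J) z0" and z = "mob (N I) z0"])
    have words: "J \<in> words m" "length J = k" if "J \<in> D" for J using D that by auto
    have "0 < r I" using r_pos words(1)[OF I] .
    then show \<tau>_pos: "0 < \<tau>" using \<tau> I by force
    show "0 < \<sigma>" using \<eta> H by (simp add: \<sigma>_def)
    have near: "cmod (mob (N J) z - mob (N J) z0) \<le> H\<^sup>2 * \<tau> * \<Delta>" if "J \<in> D" "z \<in> K" for J z
    proof -
      have "cmod (mob (N J) z - mob (N J) z0) \<le> H\<^sup>2 * r J * cmod (z - z0)"
        using mob_dist(2)[OF words(1) that(2) z0(2)] that by simp
      also have "\<dots> \<le> H\<^sup>2 * \<tau> * \<Delta>"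
        using \<tau> that K_diam[OF that(2) z0(2)] \<tau>_pos r_pos[OF words(1)[OF that(1)]]
        by (intro mult_mono) auto
      finally show ?thesis .
    qed
    show "cmod (mob (N J) z0 - mob (N I) z0) \<le> R * \<tau>"
      if J: "J \<in> {J \<in> D. word_map \<psi> I ` closure V \<inter> word_map \<psi> J ` closure V \<noteq> {}}" for J
    proof -
      have JD: "J \<in> D" using J by simp
      obtain p q where pq: "p \<in> closure V" "q \<in> closure V" "word_map \<psi> I p = word_map \<psi> J q" using J by blast
      then have eq: "mob (N I) (chart B p) = mob (N J) (chart B q)"
        using word[OF words(1)[OF I] pq(1)] word[OF words(1)[OF JD] pq(2)] by simp
      have "mob (N J) z0 - mob (N I) z0 = (mob (N I) (chart B p) - mob (N I) z0) - (mob (N J) (chart B q) - mob (N J) z0)"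
        using eq by simp
      then have "cmod (mob (N J) z0 - mob (N I) z0) \<le>
          cmod (mob (N I) (chart B p) - mob (N I) z0) + cmod (mob (N J) (chart B q) - mob (N J) z0)"
        by (metis norm_triangle_ineq4)
      also have "\<dots> \<le> H\<^sup>2 * \<tau> * \<Delta> + H\<^sup>2 * \<tau> * \<Delta>" by (intro add_mono near I JD chK pq)
      finally show ?thesis by (simp add: R_def mult_ac)
    qed
    show "\<sigma> * \<tau> \<le> cmod (mob (N J) z0 - mob (N J') z0)"
      if J: "J \<in> {J \<in> D. word_map \<psi> I ` closure V \<inter> word_map \<psi> J ` closure V \<noteq> {}}"
        "J' \<in> {J \<in> D. word_map \<psi> I ` closure V \<inter> word_map \<psi> J ` closure V \<noteq> {}}" "J \<noteq> J'" for J J'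
    proof (rule ccontr)
      assume "\<not> \<sigma> * \<tau> \<le> cmod (mob (N J) z0 - mob (N J') z0)"
      then have lt: "cmod (mob (N J) z0 - mob (N J') z0) < \<sigma> * \<tau>" by simp
      have JD: "J \<in> D" "J' \<in> D" using J by auto
      have W: "J \<in> words m" "J' \<in> words m" using words JD by auto
      have "\<sigma> * \<tau> \<le> \<eta> * (r J' / H\<^sup>2)" 
      proof -
        have "\<tau> / 2 \<le> r J'" using \<tau> JD by force
        then have "\<eta> * ((\<tau> / 2) / H\<^sup>2) \<le> \<eta> * (r J' / H\<^sup>2)"
          using \<eta> by (intro mult_left_mono divide_right_mono) auto
        then show ?thesis by (simp add: \<sigma>_def mult.commute)
      qed
      also have "\<dots> \<le> \<eta> * (1 / (cmod (mden (N J') z0) * cmod (mden (N J') z0)))"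
        using \<eta> inv_den(1)[OF W(2) z0(2) z0(2)] by (intro mult_left_mono) auto
      also have "\<dots> = \<eta> / (cmod (mden (N J') z0))\<^sup>2" by (simp add: power2_eq_square)
      \<comment> \<open>Base points that are too close would put the one of \<open>J\<close> into
        the image of \<open>U\<close> under \<open>J'\<close>, contradicting the disjointness of the
        images of \<open>V\<close> under distinct words of equal length.\<close>
      finally have "mob (N J) z0 \<in> mob (N J') ` U" using lt by (intro \<eta>(2) W) simp
      then obtain q where q: "q \<in> V" "mob (N J) z0 = mob (N J') (chart B q)" by (auto simp: U_def)
      have cl: "p0 \<in> closure V" "q \<in> closure V" using p0 q(1) Vcl by blast+
      have "chart B (word_map \<psi> J p0) = chart B (word_map \<psi> J' q)"
        using word[OF W(1) cl(1)] word[OF W(2) cl(2)] q(2) by (simp add: z0_def)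
      moreover have "word_map \<psi> J p0 \<in> chart_domain B" "word_map \<psi> J' q \<in> chart_domain B"
        using word[OF W(1) cl(1)] word[OF W(2) cl(2)] chart by blast+
      ultimately have "word_map \<psi> J p0 = word_map \<psi> J' q" using inj_onD[OF inj_on_chart[OF chart(1)]] by blast
      moreover have "word_map \<psi> J ` V \<inter> word_map \<psi> J' ` V = {}"
        using words JD J(3) by (intro word_images_disjoint[OF inj disj maps_V W]) auto
      ultimately show False using p0 q by blast
    qed
  qed
  \<comment> \<open>The maximum provides one constant for both the upper distance bound and the
    decay.\<close>
  have "conformal_ifs m \<psi> V r (c / (H\<^sup>2 * C)) (max (C * H\<^sup>2 / c) (H\<^sup>2)) L n"
  proof
    show "open V" "V \<noteq> {}" "compact (closure V)" "0 < L" "L < 1" by fact+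
    show "0 < c / (H\<^sup>2 * C)" using c H C by simp
    fix I assume I: "I \<in> words m"
    show "dist (word_map \<psi> I x) (word_map \<psi> I y) \<le> max (C * H\<^sup>2 / c) (H\<^sup>2) * r I * dist x y"
      if "x \<in> closure V" "y \<in> closure V" for x y
    proof -
      have "C * H\<^sup>2 / c * r I * dist x y \<le> max (C * H\<^sup>2 / c) (H\<^sup>2) * r I * dist x y"
        using r_pos[OF I] by (intro mult_right_mono) auto
      then show ?thesis using upper[OF I that] by linarith
    qed
    have "H\<^sup>2 * L ^ length I \<le> max (C * H\<^sup>2 / c) (H\<^sup>2) * L ^ length I"
      using L by (intro mult_right_mono) auto
    then show "r I \<le> max (C * H\<^sup>2 / c) (H\<^sup>2) * L ^ length I" using decay[OF I] by linarith
  qed (fact maps_V maps_cl r_pos lower overlap)+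
  then show ?thesis unfolding \<psi>_def r_def by blast
qed

text \<open>The residual set of an open \<open>V\<close> can be empty while the one of its closure
  is not. Hence the formula is stated for the former under nonemptiness, which supplies a word
  mapping the closure into \<open>V\<close>, and for the latter without condition.\<close>

theorem theorem5:
  fixes m :: nat
    and f :: "nat \<Rightarrow> complex ^ 2 \<Rightarrow> complex ^ 2"
    and A :: "nat \<Rightarrow> complex ^ 2 ^ 2"
    and P B :: "complex ^ 2 ^ 2"
    and V :: "cp1 set"
  assumes "1 \<le> m"
    and automorphisms:
      "\<And>i. i \<in> {1..m} \<Longrightarrow> Vector_Spaces.linear (*s) (*s) (f i) \<and> bij (f i)"
    and coordinates: "invertible P"
      "\<And>i v. i \<in> {1..m} \<Longrightarrow> f i (P *v v) = P *v (A i *v v)"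
    and SL2: "\<And>i. i \<in> {1..m} \<Longrightarrow> det (A i) = 1"
    and V: "open V" "V \<noteq> {}" "V \<noteq> UNIV"
    and OSC: "open_set_condition m (\<lambda>i. induced_map (f i)) V"
    and chart: "invertible B" "closure V \<subseteq> chart_domain B"
    and contractions: "\<And>i. i \<in> {1..m} \<Longrightarrow>
      \<exists>L<1. L-lipschitz_on (chart B ` closure V) (in_chart B (induced_map (f i)))"
  shows "(residual_set m (\<lambda>i. induced_map (f i)) V \<noteq> {} \<longrightarrow>
        2 * hausdorff_dim (residual_set m (\<lambda>i. induced_map (f i)) V) = semigroup_exponent m A)
    \<and> 2 * hausdorff_dim (residual_set m (\<lambda>i. induced_map (f i)) (closure V))
        = semigroup_exponent m A"
proof -
  define r where "r = (\<lambda>I. 1 / (max_norm (word_matrix A I))\<^sup>2)"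
  obtain c C L N where "conformal_ifs m (\<lambda>i. induced_map (f i)) V r c C L N"
    using projective_conformal_ifs[OF automorphisms coordinates SL2 V(1,2) OSC chart contractions]
    unfolding r_def by blast
  then interpret conformal_ifs m "\<lambda>i. induced_map (f i)" V r c C L N .
  have powr: "r I powr t = max_norm (word_matrix A I) powr (- (2 * t))" if "I \<in> words m" for I t
  proof -
    define a where "a = max_norm (word_matrix A I)"
    have "0 < a" unfolding a_def using det_word_matrix[of m A I] SL2 that by (intro max_norm_pos) auto
    then have "r I = a powr (- 2)" by (simp add: r_def a_def powr_minus_divide)
    then show ?thesis by (simp add: powr_powr a_def)
  qed
  have summ: "(\<lambda>I. r I powr t) summable_on words m \<longleftrightarrow>
      (\<Sum>\<^sub>\<infinity>I\<in>words m. ennreal (max_norm (word_matrix A I) powr (- (2 * t)))) \<noteq> \<infinity>" for t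
  proof -
    have "(\<Sum>\<^sub>\<infinity>I\<in>words m. ennreal (max_norm (word_matrix A I) powr (- (2 * t)))) = (\<Sum>\<^sub>\<infinity>I\<in>words m. ennreal (r I powr t))"
      by (intro infsum_cong) (simp add: powr)
    then show ?thesis using infsum_ennreal_eq_top_iff[of "words m" "\<lambda>I. r I powr t"] by simp
  qed
  have "2 * hausdorff_dim (residual_set m (\<lambda>i. induced_map (f i)) (closure V)) = semigroup_exponent m A"
  proof (rule hausdorff_dim_eq_exponent[OF summ hausdorff_measure_residual_eq_0])
    fix u t :: real assume "0 \<le> u" "u < t" "\<not> (\<lambda>I. r I powr t) summable_on words m"
    then show "hausdorff_measure u (residual_set m (\<lambda>i. induced_map (f i)) (closure V)) \<noteq> 0"
      \<comment> \<open>For the closed residual set the one-letter word \<open>[1]\<close> serves as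
        the inserted word \<open>J\<close>, since all words preserve the closure of
        \<open>V\<close>.\<close>
      using \<open>1 \<le> m\<close> maps(2) word_maps_closure[of "[1]"]
      by (intro hausdorff_measure_pos_residual[of u t "[1]"]) auto
  qed
  moreover have "2 * hausdorff_dim (residual_set m (\<lambda>i. induced_map (f i)) V) = semigroup_exponent m A"
    if ne: "residual_set m (\<lambda>i. induced_map (f i)) V \<noteq> {}"
  proof (rule hausdorff_dim_eq_exponent[OF summ])
    fix t :: real assume t: "0 < t" "(\<lambda>I. r I powr t) summable_on words m"
    have sub: "residual_set m (\<lambda>i. induced_map (f i)) V \<subseteq> residual_set m (\<lambda>i. induced_map (f i)) (closure V)"
      by (rule residual_set_mono[OF closure_subset])
    show "hausdorff_measure t (residual_set m (\<lambda>i. induced_map (f i)) V) = 0"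
      using hausdorff_measure_mono[OF sub, of t] hausdorff_measure_residual_eq_0[OF t] by simp
  next
    fix u t :: real assume ut: "0 \<le> u" "u < t" "\<not> (\<lambda>I. r I powr t) summable_on words m"
    obtain J where "J \<in> words m" "J \<noteq> []" "word_map (\<lambda>i. induced_map (f i)) J ` closure V \<subseteq> V"
      using exists_word_into_V[OF ne] .
    then show "hausdorff_measure u (residual_set m (\<lambda>i. induced_map (f i)) V) \<noteq> 0"
      using maps(1) by (intro hausdorff_measure_pos_residual[OF ut]) auto
  qed
  ultimately show ?thesis by blast
qed

end
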